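(* As $n\to\infty$, the conditional expectation $\frac1n\mathbf{E}[D_n(W_n)\mid T_n]$ converges almost surely to a limit that is (almost surely) positive. Moreover, $\frac1n\mathbf{E}[D_n(W_n)]$ converges to some positive number as $n\to\infty$.
   Context: The random friend tree process $(T_n)_{n\ge 2}$ is defined as follows. $T_2$ is a single edge joining vertices labelled $1$ and $2$. For $n\ge 2$, given $T_n$ (and the past of the process), $V_n$ is chosen uniformly at random in $\{1,\dots,n\}$, and then $W_n$ is a uniformly random neighbour of $V_n$ in $T_n$; $T_{n+1}$ is obtained from $T_n$ by adding a new vertex labelled $n+1$ joined by an edge to $W_n$. Thus $T_n$ is a tree with vertex set $[n]=\{1,\dots,n\}$. For $v\in[n]$, $D_n(v)$ is the degree of $v$ in $T_n$; in particular $D_n(W_n)$ is the degree in $T_n$ of the vertex $W_n$. *)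

theory Defs
  imports "HOL-Probability.Probability"
begin

(* An undirected graph is given by its set of edges {v, w}; all graphs below are trees on
   {1..n} with n \<ge> 2, so the edge set determines the vertex set. *)

definition neighbours :: "nat set set \<Rightarrow> nat \<Rightarrow> nat set" where
  "neighbours E v = {w. {v, w} \<in> E}"

definition vertex_degree :: "nat set set \<Rightarrow> nat \<Rightarrow> nat" where
  "vertex_degree E v = card (neighbours E v)"

(* The sigma-algebra generated by a discrete random variable X. The power set is used on the
   target side; all variables X it is applied to take only countably many values. *)

definition sigma_of :: "'a measure \<Rightarrow> ('a \<Rightarrow> 'b) \<Rightarrow> 'a measure" where
  "sigma_of M X = vimage_algebra (space M) X (count_space UNIV)"

definition past ::
    "(nat \<Rightarrow> 'a \<Rightarrow> nat set set) \<Rightarrow> (nat \<Rightarrow> 'a \<Rightarrow> nat) \<Rightarrow> (nat \<Rightarrow> 'a \<Rightarrow> nat) \<Rightarrow> nat \<Rightarrow> 'a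
      \<Rightarrow> nat set set list \<times> (nat \<times> nat) list" where
  "past T V W n \<omega> = (map (\<lambda>k. T k \<omega>) [2..<Suc n], map (\<lambda>k. (V k \<omega>, W k \<omega>)) [2..<n])"

(* Any realisation of the process on any probability space M: the conditional law of V n given
   the past up to T n is uniform on {1..n}, and the conditional law of W n given this past and
   V n is uniform on the neighbours of V n in T n. Values at indices below 2 are irrelevant. *)

locale random_friend_tree = prob_space M
  for M :: "'a measure" +
  fixes T :: "nat \<Rightarrow> 'a \<Rightarrow> nat set set"
    and V :: "nat \<Rightarrow> 'a \<Rightarrow> nat"
    and W :: "nat \<Rightarrow> 'a \<Rightarrow> nat"
  assumes T_measurable: "\<And>n. n \<ge> 2 \<Longrightarrow> T n \<in> measurable M (count_space UNIV)"
    and V_measurable: "\<And>n. n \<ge> 2 \<Longrightarrow> V n \<in> measurable M (count_space UNIV)"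
    and W_measurable: "\<And>n. n \<ge> 2 \<Longrightarrow> W n \<in> measurable M (count_space UNIV)"
    and T_2: "\<And>\<omega>. \<omega> \<in> space M \<Longrightarrow> T 2 \<omega> = {{1, 2}}"
    and T_Suc: "\<And>n \<omega>. n \<ge> 2 \<Longrightarrow> \<omega> \<in> space M \<Longrightarrow>
      T (Suc n) \<omega> = insert {W n \<omega>, Suc n} (T n \<omega>)"
    and V_law: "\<And>n v. n \<ge> 2 \<Longrightarrow>
      AE \<omega> in M. real_cond_exp M (sigma_of M (past T V W n))
          (indicator {\<omega> \<in> space M. V n \<omega> = v}) \<omega>
        = pmf (pmf_of_set {1..n}) v"
    and W_law: "\<And>n w. n \<ge> 2 \<Longrightarrow>
      AE \<omega> in M. real_cond_exp M (sigma_of M (\<lambda>\<omega>. (past T V W n \<omega>, V n \<omega>)))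
          (indicator {\<omega> \<in> space M. W n \<omega> = w}) \<omega>
        = pmf (pmf_of_set (neighbours (T n \<omega>) (V n \<omega>))) w"

end

theory Submission imports Defs begin

text \<open>
  Write \<open>d(v)\<close> for the degree of \<open>v\<close> in \<open>T n\<close> and \<open>a(w)\<close> for the sum of \<open>1/d(v)\<close> over the
  neighbours \<open>v\<close> of \<open>w\<close>. Given the past, \<open>W n = w\<close> has probability \<open>a(w)/n\<close>, so the conditional
  expectation of \<open>d(W n)/n\<close> is \<open>X/n\<^sup>2\<close>, where the degree energy \<open>X\<close> is the sum of \<open>a(w) d(w)\<close>. It lies
  in \<open>[0, 1]\<close>. By dominated convergence, everything follows once \<open>X/n\<^sup>2\<close> converges almost surely to a
  positive limit \<open>L\<close>.

  \<^emph>\<open>Convergence.\<close> A new leaf at \<open>w\<close> raises \<open>X\<close> by at most \<open>a(w) + d(w) + 2\<close>. Since \<open>a(w) \<le> d(w)\<close> and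
  the \<open>a(w)\<close> add up to \<open>n\<close>, averaging over \<open>w\<close> shows that the mean growth of \<open>X\<close> is at most
  \<open>2 X/n + 2\<close>. Hence \<open>X/(n(n+1)) + 2/(n+1)\<close> is a nonnegative supermartingale
  (\<open>scaled_energy_supermartingale\<close>). Its increments are \<open>O(1/n)\<close>, which permits an elementary proof of
  its convergence (\<open>nonneg_supermartingale_converges\<close>): in the Doob decomposition the compensator is
  monotone with bounded expectation, and the martingale part is a series of orthogonal terms of size
  \<open>O(1/i)\<close>, which converges almost surely (\<open>orthogonal_AE_summable\<close>).

  \<^emph>\<open>Positivity.\<close> Let \<open>l(u)\<close> be the number of leaves adjacent to \<open>u\<close>. As \<open>l(u) \<le> a(u)\<close> and
  \<open>l(u) \<le> d(u)\<close>, the energy \<open>X\<close> is at least \<open>l(u)\<^sup>2\<close>, so it suffices to exhibit a vertex with linearly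
  many leaves. The count \<open>l(u)\<close> goes up by one with probability \<open>a(u)/n \<ge> l(u)/n\<close>, and down by one
  with probability \<open>l(u)/(n d(u)) \<le> 1/n\<close> only, because a leaf at \<open>u\<close> is itself chosen as the neighbour
  only when \<open>u\<close> was chosen first. So a large \<open>l(u)\<close> behaves like the number of balls of one colour in a
  Polya urn. Quantitatively, \<open>n/(l(u) - 3)\<close> is a supermartingale while \<open>l(u) \<ge> 6\<close>, and therefore, once
  a vertex has \<open>k\<close> leaves, the conditional probability that it fails to keep linearly many of them, and with
  it that of \<open>L \<le> 0\<close>, is at most \<open>2/(k - 3)\<close> (\<open>leafy_vertex_survives\<close>). Finally a vertex with \<open>k\<close> leaves appears at some time almost
  surely (\<open>few_leaves_null\<close>): the sum of the \<open>l(u)\<^sup>2\<close>, divided by \<open>n\<close>, is at most \<open>k\<^sup>2\<close> before that time, yet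
  its mean grows by at least \<open>1/(n+1)\<close> in each step, and the harmonic series diverges. Splitting the
  event \<open>L \<le> 0\<close> at the first time at which some vertex has \<open>k\<close> leaves gives it probability at most
  \<open>2/(k - 3)\<close>, for every \<open>k \<ge> 6\<close>.
\<close>

section \<open>Trees grown by attaching leaves\<close>

text \<open>
  The trees that the process can reach. The graphs \<open>T n\<close> belong to this class almost surely but not
  surely, since the law of \<open>W n\<close> is prescribed up to null sets only. All combinatorial statements below
  are therefore about this class.
\<close>

inductive grown :: "nat \<Rightarrow> nat set set \<Rightarrow> bool" where
  edge: "grown 2 {{1, 2}}"
| attach: "grown n E \<Longrightarrow> w \<in> {1..n} \<Longrightarrow> grown (Suc n) (insert {w, Suc n} E)"

abbreviation attach_leaf :: "nat \<Rightarrow> nat \<Rightarrow> nat set set \<Rightarrow> nat set set" where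
  "attach_leaf n w E \<equiv> insert {w, Suc n} E"

lemma neighbours_sym: "v \<in> neighbours E w \<longleftrightarrow> w \<in> neighbours E v"
  by (simp add: neighbours_def insert_commute)

lemma grown_ge_2: "grown n E \<Longrightarrow> n \<ge> 2"
  by (induction rule: grown.induct) auto

lemma grown_edge:
  "grown n E \<Longrightarrow> e \<in> E \<Longrightarrow> \<exists>v w. e = {v, w} \<and> v \<noteq> w \<and> v \<in> {1..n} \<and> w \<in> {1..n}"
proof (induction arbitrary: e rule: grown.induct)
  case edge
  have "e = {1, 2} \<and> (1::nat) \<noteq> 2 \<and> (1::nat) \<in> {1..2} \<and> (2::nat) \<in> {1..2}" using edge by simp
  then show ?case by blast
next
  case (attach n E w)
  show ?case
  proof (cases "e \<in> E")
    case True
    then obtain v u where "e = {v, u}" "v \<noteq> u" "v \<in> {1..n}" "u \<in> {1..n}" using attach by metis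
    then show ?thesis by (intro exI[of _ v] exI[of _ u]) auto
  next
    case False
    then have "e = {w, Suc n}" using attach by simp
    then show ?thesis using attach by (intro exI[of _ w] exI[of _ "Suc n"]) auto
  qed
qed

lemma neighbours_range:
  assumes "grown n E" "v \<in> neighbours E w"
  shows "v \<in> {1..n}" "w \<in> {1..n}" "v \<noteq> w"
proof -
  have "{w, v} \<in> E" using assms(2) by (simp add: neighbours_def)
  from grown_edge[OF assms(1) this] obtain x y
    where "{w, v} = {x, y}" "x \<noteq> y" "x \<in> {1..n}" "y \<in> {1..n}" by blast
  then show "v \<in> {1..n}" "w \<in> {1..n}" "v \<noteq> w" by (auto simp: doubleton_eq_iff)
qed

lemma finite_neighbours: "grown n E \<Longrightarrow> finite (neighbours E w)"
  by (rule finite_subset[of _ "{1..n}"]) (auto dest: neighbours_range)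

lemma neighbours_attach:
  assumes "grown n E" "w \<in> {1..n}"
  shows "neighbours (attach_leaf n w E) u =
    (if u = w then insert (Suc n) (neighbours E w) else if u = Suc n then {w} else neighbours E u)"
proof -
  have "neighbours E (Suc n) = {}" using neighbours_range(2)[OF assms(1), of _ "Suc n"] by auto
  then show ?thesis using assms(2)
    by (auto simp: neighbours_def doubleton_eq_iff)
qed

lemma neighbours_nonempty: "grown n E \<Longrightarrow> v \<in> {1..n} \<Longrightarrow> neighbours E v \<noteq> {}"
proof (induction arbitrary: v rule: grown.induct)
  case edge
  then have "v = 1 \<or> v = 2" by auto
  then have "{v, 3 - v} \<in> {{1, 2::nat}}" by auto
  then show ?case unfolding neighbours_def by blast
next
  case (attach n E w)
  then show ?case by (auto simp: neighbours_attach le_Suc_eq)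
qed

lemma degree_attach:
  assumes "grown n E" "w \<in> {1..n}"
  shows "vertex_degree (attach_leaf n w E) u =
    (if u = w then Suc (vertex_degree E w) else if u = Suc n then 1 else vertex_degree E u)"
proof -
  have "Suc n \<notin> neighbours E w" using neighbours_range(1)[OF assms(1)] by fastforce
  then show ?thesis
    by (simp add: vertex_degree_def neighbours_attach[OF assms] finite_neighbours[OF assms(1)])
qed

lemma degree_pos: "grown n E \<Longrightarrow> v \<in> {1..n} \<Longrightarrow> vertex_degree E v \<ge> 1"
  using neighbours_nonempty finite_neighbours
  by (metis One_nat_def Suc_leI card_gt_0_iff vertex_degree_def)

lemma degree_le: "grown n E \<Longrightarrow> vertex_degree E v \<le> n"
  unfolding vertex_degree_def
  using card_mono[of "{1..n}" "neighbours E v"] neighbours_range(1) by fastforce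

lemma finite_grown: "finite {E. grown n E}"
proof (rule finite_subset)
  show "{E. grown n E} \<subseteq> Pow (Pow {1..n})" using grown_edge by fastforce
qed simp

section \<open>Averages over one step of the process\<close>

text \<open>
  This is \<open>n\<close> times the probability that the process chooses \<open>w\<close> as the neighbour of a uniform vertex.
\<close>

definition weight :: "nat set set \<Rightarrow> nat \<Rightarrow> real" where
  "weight E w = (\<Sum>v\<in>neighbours E w. 1 / real (vertex_degree E v))"

text \<open>
  The conditional mean of \<open>f (W n)\<close> given that \<open>T n\<close> is \<open>E\<close>.
\<close>

definition step_mean :: "nat \<Rightarrow> nat set set \<Rightarrow> (nat \<Rightarrow> real) \<Rightarrow> real" where
  "step_mean n E f = (\<Sum>w=1..n. weight E w / real n * f w)"

lemma sum_neighbours_swap: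
  assumes "grown n E"
  shows "(\<Sum>w=1..n. \<Sum>v\<in>neighbours E w. f v w) = (\<Sum>w=1..n. \<Sum>v\<in>neighbours E w. (f w v :: real))"
proof -
  have nb: "neighbours E w = {v\<in>{1..n}. v \<in> neighbours E w}" for w
    using neighbours_range(1)[OF assms] by auto
  have "(\<Sum>w=1..n. \<Sum>v\<in>neighbours E w. f v w) = (\<Sum>w=1..n. \<Sum>v | v\<in>{1..n} \<and> v \<in> neighbours E w. f v w)"
    by (intro sum.cong refl arg_cong[where f="sum _"]) (use nb in auto)
  also have "\<dots> = (\<Sum>v=1..n. \<Sum>w | w\<in>{1..n} \<and> v \<in> neighbours E w. f v w)"
    by (rule sum.swap_restrict) auto
  also have "\<dots> = (\<Sum>v=1..n. \<Sum>w\<in>neighbours E v. f v w)"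
    by (intro sum.cong refl) (use nb neighbours_sym in blast)
  finally show ?thesis .
qed

text \<open>
  Every vertex \<open>v\<close> distributes a total mass of \<open>1\<close> evenly among its \<open>d(v)\<close> neighbours.
\<close>

lemma sum_weight:
  assumes "grown n E"
  shows "(\<Sum>w=1..n. weight E w) = real n"
proof -
  have "(\<Sum>w=1..n. weight E w) = (\<Sum>w=1..n. \<Sum>v\<in>neighbours E w. 1 / real (vertex_degree E w))"
    unfolding weight_def by (rule sum_neighbours_swap[OF assms])
  also have "\<dots> = (\<Sum>w=1..n. 1)"
  proof (intro sum.cong refl)
    fix w assume "w \<in> {1..n}"
    then show "(\<Sum>v\<in>neighbours E w. 1 / real (vertex_degree E w)) = 1"
      using degree_pos[OF assms, of w] by (simp add: vertex_degree_def)
  qed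
  finally show ?thesis by simp
qed

lemma weight_nonneg: "weight E w \<ge> 0"
  unfolding weight_def by (intro sum_nonneg) auto

lemma weight_le_degree: "weight E w \<le> real (vertex_degree E w)"
proof -
  have "weight E w \<le> (\<Sum>v\<in>neighbours E w. 1)"
    unfolding weight_def
    by (intro sum_mono) (simp add: divide_le_eq_1, linarith)
  then show ?thesis by (simp add: vertex_degree_def)
qed

lemma step_mean_const: "grown n E \<Longrightarrow> step_mean n E (\<lambda>_. c) = c"
  using sum_weight[of n E] grown_ge_2[of n E]
  by (simp add: step_mean_def sum_distrib_right[symmetric] sum_divide_distrib[symmetric])

lemma step_mean_mono:
  "(\<And>w. w \<in> {1..n} \<Longrightarrow> f w \<le> g w) \<Longrightarrow> step_mean n E f \<le> step_mean n E g"
  unfolding step_mean_def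
  by (intro sum_mono mult_left_mono) (auto simp: weight_nonneg)

lemma step_mean_add: "step_mean n E (\<lambda>w. f w + g w) = step_mean n E f + step_mean n E g"
  unfolding step_mean_def by (simp add: distrib_left sum.distrib)

lemma step_mean_cmult: "step_mean n E (\<lambda>w. c * f w) = c * step_mean n E f"
  unfolding step_mean_def by (simp add: algebra_simps sum_distrib_left)

lemma step_mean_sum: "step_mean n E (\<lambda>w. \<Sum>u\<in>A. f u w) = (\<Sum>u\<in>A. step_mean n E (f u))"
  unfolding step_mean_def by (simp add: sum_distrib_left sum.swap[of _ A])

lemma step_mean_abs_diff_le:
  assumes "grown n E" "\<And>w. w \<in> {1..n} \<Longrightarrow> \<bar>f w - c\<bar> \<le> b"
  shows "\<bar>step_mean n E f - c\<bar> \<le> b"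
proof -
  have "step_mean n E (\<lambda>_. c - b) \<le> step_mean n E f" "step_mean n E f \<le> step_mean n E (\<lambda>_. c + b)"
    using assms(2) by (intro step_mean_mono; fastforce simp: abs_le_iff)+
  then show ?thesis by (simp add: step_mean_const[OF assms(1)] abs_le_iff)
qed

section \<open>The degree energy\<close>

definition degree_energy :: "nat \<Rightarrow> nat set set \<Rightarrow> real" where
  "degree_energy n E = (\<Sum>w=1..n. real (vertex_degree E w) * weight E w)"

lemma step_mean_degree:
  "step_mean n E (\<lambda>w. real (vertex_degree E w)) = degree_energy n E / real n"
  by (simp add: step_mean_def degree_energy_def sum_divide_distrib mult.commute)

lemma degree_energy_nonneg: "degree_energy n E \<ge> 0"
  unfolding degree_energy_def by (intro sum_nonneg mult_nonneg_nonneg weight_nonneg) auto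

lemma degree_energy_le:
  assumes "grown n E"
  shows "degree_energy n E \<le> real n ^ 2"
proof -
  have "degree_energy n E \<le> (\<Sum>w=1..n. real n * weight E w)"
    unfolding degree_energy_def
    by (intro sum_mono mult_right_mono weight_nonneg) (use degree_le[OF assms] in auto)
  also have "\<dots> = real n ^ 2"
    using sum_weight[OF assms] by (simp add: sum_distrib_left[symmetric] power2_eq_square)
  finally show ?thesis .
qed

text \<open>
  A new leaf at \<open>w\<close> turns the term of \<open>w\<close> from \<open>d a\<close> into \<open>(d + 1) (a + 1)\<close>, adds the term \<open>1/(d + 1)\<close> for
  the leaf itself, and lowers \<open>1/d\<close> to \<open>1/(d + 1)\<close> in the weight of each neighbour of \<open>w\<close>.
\<close>

lemma degree_energy_attach:
  assumes g: "grown n E" and w: "w \<in> {1..n}"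
  defines "d \<equiv> real (vertex_degree E w)"
  shows "degree_energy (Suc n) (attach_leaf n w E) - degree_energy n E =
    weight E w + d + 1 + 1 / (d + 1)
      - (\<Sum>v\<in>neighbours E w. real (vertex_degree E v)) / (d * (d + 1))"
proof -
  define E' where "E' = attach_leaf n w E"
  have d: "d \<ge> 1" using degree_pos[OF g w] by (simp add: d_def)
  note dg = degree_attach[OF g w, folded E'_def]
  note nb = neighbours_attach[OF g w, folded E'_def]
  have fin: "finite (neighbours E u)" for u using finite_neighbours[OF g] .
  have new: "Suc n \<notin> neighbours E u" for u using neighbours_range(1)[OF g, of "Suc n" u] by auto
  have ww: "w \<noteq> Suc n" using w by auto
  \<comment> \<open>The effect of the degree change of \<open>w\<close> on the weight of a neighbour.\<close>
  have inv: "1 / (d + 1) = 1 / d - 1 / (d * (d + 1))"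
  proof -
    have "d \<noteq> 0" "d + 1 \<noteq> 0" using d by auto
    then show ?thesis by (simp add: divide_simps)
  qed
  have weight_w: "weight E' w = weight E w + 1"
  proof -
    have "weight E' w = 1 / real (vertex_degree E' (Suc n))
        + (\<Sum>v\<in>neighbours E w. 1 / real (vertex_degree E' v))"
      unfolding weight_def using nb fin new by simp
    also have "(\<Sum>v\<in>neighbours E w. 1 / real (vertex_degree E' v)) = weight E w"
      unfolding weight_def
    proof (intro sum.cong refl)
      fix v assume "v \<in> neighbours E w"
      then have "v \<noteq> w" "v \<noteq> Suc n" using neighbours_range[OF g] new by blast+
      then show "1 / real (vertex_degree E' v) = 1 / real (vertex_degree E v)" by (simp add: dg)
    qed
    finally show ?thesis using ww by (simp add: dg)
  qed
  have weight_new: "weight E' (Suc n) = 1 / (d + 1)"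
    unfolding weight_def d_def using nb ww by (simp add: dg add.commute)
  have weight_u: "weight E' u = weight E u - (if u \<in> neighbours E w then 1 / (d * (d + 1)) else 0)"
    if u: "u \<in> {1..n}" "u \<noteq> w" for u
  proof -
    have un: "u \<noteq> Suc n" using u by auto
    have "weight E' u = (\<Sum>v\<in>neighbours E u. 1 / real (vertex_degree E' v))"
      unfolding weight_def using nb u un by simp
    also have "\<dots> = (\<Sum>v\<in>neighbours E u. 1 / real (vertex_degree E v) - (if v = w then 1 / (d * (d + 1)) else 0))"
    proof (intro sum.cong refl)
      fix v assume "v \<in> neighbours E u"
      then have "v \<noteq> Suc n" using new by blast
      then show "1 / real (vertex_degree E' v) = 1 / real (vertex_degree E v) - (if v = w then 1 / (d * (d + 1)) else 0)"
        using inv by (auto simp: dg d_def[symmetric] add.commute)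
    qed
    also have "\<dots> = weight E u - (if w \<in> neighbours E u then 1 / (d * (d + 1)) else 0)"
      unfolding weight_def sum_subtractf by (simp add: fin)
    finally show ?thesis using neighbours_sym[of u E w] by simp
  qed
  have split: "{1..n} = insert w ({1..n} - {w})" using w by blast
  have "degree_energy (Suc n) E' = (\<Sum>u=1..n. real (vertex_degree E' u) * weight E' u) + 1 / (d + 1)"
    unfolding degree_energy_def using weight_new ww by (simp add: dg)
  also have "(\<Sum>u=1..n. real (vertex_degree E' u) * weight E' u)
      = (d + 1) * (weight E w + 1) + (\<Sum>u\<in>{1..n}-{w}. real (vertex_degree E' u) * weight E' u)"
    by (subst split, subst sum.insert) (auto simp: dg weight_w d_def)
  also have "(\<Sum>u\<in>{1..n}-{w}. real (vertex_degree E' u) * weight E' u)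
     = (\<Sum>u\<in>{1..n}-{w}. real (vertex_degree E u) * weight E u
          - (if u \<in> neighbours E w then real (vertex_degree E u) / (d * (d + 1)) else 0))"
    by (intro sum.cong refl) (auto simp: dg weight_u right_diff_distrib)
  also have "\<dots> = (\<Sum>u\<in>{1..n}-{w}. real (vertex_degree E u) * weight E u)
      - (\<Sum>u\<in>{1..n}-{w}. if u \<in> neighbours E w then real (vertex_degree E u) / (d * (d + 1)) else 0)"
    by (rule sum_subtractf)
  also have "(\<Sum>u\<in>{1..n}-{w}. real (vertex_degree E u) * weight E u) = degree_energy n E - d * weight E w"
    unfolding degree_energy_def d_def using w by (simp add: sum_diff1)
  also have "(\<Sum>u\<in>{1..n}-{w}. if u \<in> neighbours E w then real (vertex_degree E u) / (d * (d + 1)) else 0)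
      = (\<Sum>v\<in>neighbours E w. real (vertex_degree E v) / (d * (d + 1)))"
    by (intro sum.mono_neutral_cong_right) (use neighbours_range[OF g] in \<open>blast | simp\<close>)+
  finally show ?thesis unfolding E'_def sum_divide_distrib[symmetric]
    by (simp add: algebra_simps)
qed

text \<open>
  The first bound drops the negative term of the exact formula, since an upper bound is all that a
  supermartingale needs. For the second, that term is at most \<open>n\<close> because all degrees are.
\<close>

lemma degree_energy_attach_bounds:
  assumes g: "grown n E" and w: "w \<in> {1..n}"
  shows "degree_energy (Suc n) (attach_leaf n w E) - degree_energy n E
      \<le> weight E w + real (vertex_degree E w) + 2" (is ?up)
    and "\<bar>degree_energy (Suc n) (attach_leaf n w E) - degree_energy n E\<bar> \<le> 3 * real n" (is ?abs)
proof -
  define d where "d = real (vertex_degree E w)"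
  define s where "s = (\<Sum>v\<in>neighbours E w. real (vertex_degree E v))"
  have d: "d \<ge> 1" using degree_pos[OF g w] by (simp add: d_def)
  have s0: "s \<ge> 0" unfolding s_def by (intro sum_nonneg) auto
  have "s \<le> (\<Sum>v\<in>neighbours E w. real n)"
    unfolding s_def by (intro sum_mono) (use degree_le[OF g] in auto)
  then have "s \<le> d * real n" by (simp add: d_def vertex_degree_def)
  also have "\<dots> \<le> d * (d + 1) * real n" using d by (intro mult_right_mono) auto
  finally have s1: "s / (d * (d + 1)) \<le> real n"
    using d by (simp add: divide_le_eq mult.commute)
  have s2: "s / (d * (d + 1)) \<ge> 0" using s0 d by simp
  have inv: "1 / (d + 1) \<le> 1/2" "1 / (d + 1) \<ge> 0" using d by (auto simp: field_simps)
  note eq = degree_energy_attach[OF g w, folded d_def s_def]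
  show ?up using eq s2 inv unfolding d_def[symmetric] by linarith
  have new: "neighbours E w \<subseteq> {1..n} - {w}" using neighbours_range[OF g] by blast
  have "d \<le> real (card ({1..n} - {w}))"
    unfolding d_def vertex_degree_def by (intro of_nat_mono card_mono new) auto
  also have "\<dots> = real n - 1" using w by (subst card_Diff_singleton) auto
  finally have dn: "d \<le> real n - 1" .
  have "weight E w \<le> d" using weight_le_degree by (simp add: d_def)
  then show ?abs using eq s1 s2 inv dn weight_nonneg[of E w] d grown_ge_2[OF g] by linarith
qed

text \<open>
  The two averages of \<open>a(w)\<close> and of \<open>d(w)\<close> are both at most \<open>X/n\<close>, the first since \<open>a \<le> d\<close>; this is the source
  of the factor \<open>1 + 2/n\<close>, and hence of the normalisation by \<open>n\<^sup>2\<close>.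
\<close>

lemma step_mean_degree_energy:
  assumes g: "grown n E"
  shows "step_mean n E (\<lambda>w. degree_energy (Suc n) (attach_leaf n w E))
     \<le> degree_energy n E * (1 + 2 / real n) + 2"
proof -
  have n: "real n > 0" using grown_ge_2[OF g] by simp
  have "step_mean n E (\<lambda>w. degree_energy (Suc n) (attach_leaf n w E))
      \<le> step_mean n E (\<lambda>w. (degree_energy n E + 2) + 2 * real (vertex_degree E w))"
  proof (rule step_mean_mono)
    fix w assume "w \<in> {1..n}"
    from degree_energy_attach_bounds(1)[OF g this] weight_le_degree[of E w]
    show "degree_energy (Suc n) (attach_leaf n w E)
      \<le> (degree_energy n E + 2) + 2 * real (vertex_degree E w)" by simp
  qed
  also have "\<dots> = degree_energy n E + 2 + 2 * (degree_energy n E / real n)"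
    by (subst step_mean_add) (simp add: step_mean_const[OF g] step_mean_cmult step_mean_degree)
  finally show ?thesis by (simp add: algebra_simps)
qed

text \<open>
  Dividing by \<open>n (n + 1)\<close> absorbs the factor \<open>1 + 2/n\<close> exactly; the summand \<open>2/(n + 1)\<close> decreases by
  just the amount that the additive error \<open>2\<close> contributes after this division.
\<close>

definition scaled_energy :: "nat \<Rightarrow> nat set set \<Rightarrow> real" where
  "scaled_energy n E = degree_energy n E / (real n * (real n + 1)) + 2 / (real n + 1)"

lemma scaled_energy_supermartingale:
  assumes g: "grown n E"
  shows "step_mean n E (\<lambda>w. scaled_energy (Suc n) (attach_leaf n w E)) \<le> scaled_energy n E"
proof -
  define x where "x = real n"
  define X where "X = degree_energy n E"
  have x: "x > 0" using grown_ge_2[OF g] by (simp add: x_def)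
  have c: "scaled_energy (Suc n) E' = 1 / ((x + 1) * (x + 2)) * degree_energy (Suc n) E' + 2 / (x + 2)" for E'
    by (simp add: scaled_energy_def x_def add.commute)
  have "step_mean n E (\<lambda>w. scaled_energy (Suc n) (attach_leaf n w E))
    = 1 / ((x + 1) * (x + 2)) * step_mean n E (\<lambda>w. degree_energy (Suc n) (attach_leaf n w E)) + 2 / (x + 2)"
    unfolding c step_mean_add step_mean_cmult by (simp add: step_mean_const[OF g])
  also have "\<dots> \<le> 1 / ((x + 1) * (x + 2)) * (X * (1 + 2 / x) + 2) + 2 / (x + 2)"
    using step_mean_degree_energy[OF g] x
    by (intro add_right_mono mult_left_mono) (auto simp: x_def X_def)
  also have "\<dots> = X / (x * (x + 1)) + 2 / (x + 1)"
  proof -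
    have "x \<noteq> 0" "x + 1 \<noteq> 0" "x + 2 \<noteq> 0" using x by auto
    then show ?thesis by (simp add: divide_simps) (simp add: algebra_simps)
  qed
  finally show ?thesis by (simp add: scaled_energy_def x_def X_def)
qed

lemma scaled_energy_increment:
  assumes g: "grown n E" and w: "w \<in> {1..n}"
  shows "\<bar>scaled_energy (Suc n) (attach_leaf n w E) - scaled_energy n E\<bar> \<le> 7 / real n"
proof -
  define x where "x = real n"
  define X where "X = degree_energy n E"
  define X' where "X' = degree_energy (Suc n) (attach_leaf n w E)"
  have x: "x > 0" using grown_ge_2[OF g] by (simp add: x_def)
  have b: "\<bar>X' - X\<bar> \<le> 3 * x" using degree_energy_attach_bounds(2)[OF g w] by (simp add: x_def X_def X'_def)
  have X: "0 \<le> X" "X \<le> x ^ 2"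
    using degree_energy_nonneg degree_energy_le[OF g] by (auto simp: X_def x_def)
  have "\<bar>scaled_energy (Suc n) (attach_leaf n w E) - scaled_energy n E\<bar>
     = \<bar>(x * (X' - X) - 2 * X - 2 * x) / (x * (x + 1) * (x + 2))\<bar>"
  proof -
    have "x \<noteq> 0" "x + 1 \<noteq> 0" "x + 2 \<noteq> 0" using x by auto
    then have "X' / ((x + 1) * (x + 2)) + 2 / (x + 2) - (X / (x * (x + 1)) + 2 / (x + 1))
      = (x * (X' - X) - 2 * X - 2 * x) / (x * (x + 1) * (x + 2))"
      by (simp add: divide_simps) (simp add: algebra_simps)
    then show ?thesis by (simp add: scaled_energy_def x_def X_def X'_def add.commute)
  qed
  also have "\<dots> = \<bar>x * (X' - X) - 2 * X - 2 * x\<bar> / (x * (x + 1) * (x + 2))"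
    using x by (simp add: abs_mult)
  also have "\<dots> \<le> (7 * ((x + 1) * (x + 2))) / (x * (x + 1) * (x + 2))"
  proof (rule divide_right_mono)
    have "\<bar>x * (X' - X)\<bar> \<le> x * (3 * x)" unfolding abs_mult using b x by (intro mult_mono) auto
    then have "\<bar>x * (X' - X) - 2 * X - 2 * x\<bar> \<le> x * (3 * x) + 2 * x ^ 2 + 2 * x" using X x by linarith
    also have "\<dots> \<le> 7 * ((x + 1) * (x + 2))" using x by (simp add: power2_eq_square algebra_simps)
    finally show "\<bar>x * (X' - X) - 2 * X - 2 * x\<bar> \<le> 7 * ((x + 1) * (x + 2))" .
  qed (use x in auto)
  also have "\<dots> = 7 / x" using x by (simp add: mult.assoc)
  finally show ?thesis by (simp add: x_def)
qed

section \<open>Leaf counts\<close>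

definition leaf_count :: "nat set set \<Rightarrow> nat \<Rightarrow> nat" where
  "leaf_count E u = card {v \<in> neighbours E u. vertex_degree E v = 1}"

text \<open>
  The new vertex is a leaf at \<open>w\<close>, and \<open>w\<close> itself stops being a leaf if it was one. A vertex \<open>u \<noteq> w\<close>
  can thus only lose, and only if \<open>w\<close> was a leaf at \<open>u\<close>.
\<close>

lemma leaf_count_attach:
  assumes g: "grown n E" and w: "w \<in> {1..n}"
  shows "u \<in> {1..n} \<Longrightarrow> leaf_count (attach_leaf n w E) u =
      (if u = w then Suc (leaf_count E u)
       else leaf_count E u - (if w \<in> neighbours E u \<and> vertex_degree E w = 1 then 1 else 0))"
    and "leaf_count (attach_leaf n w E) (Suc n) \<le> 1"
proof -
  define E' where "E' = attach_leaf n w E"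
  note dg = degree_attach[OF g w, folded E'_def]
  note nb = neighbours_attach[OF g w, folded E'_def]
  have fin: "finite (neighbours E u)" for u using finite_neighbours[OF g] .
  have new: "Suc n \<notin> neighbours E u" for u using neighbours_range(1)[OF g, of "Suc n" u] by auto
  have ww: "w \<noteq> Suc n" using w by auto
  have d: "vertex_degree E w \<ge> 1" using degree_pos[OF g w] .
  have "card {v \<in> neighbours E' (Suc n). vertex_degree E' v = 1} \<le> card {w}"
    by (intro card_mono) (use nb ww in auto)
  then show "leaf_count (attach_leaf n w E) (Suc n) \<le> 1"
    by (simp add: leaf_count_def E'_def)
  assume u: "u \<in> {1..n}"
  have self: "w \<notin> neighbours E w" using neighbours_range(3)[OF g, of w w] by auto
  show "leaf_count (attach_leaf n w E) u =
      (if u = w then Suc (leaf_count E u)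
       else leaf_count E u - (if w \<in> neighbours E u \<and> vertex_degree E w = 1 then 1 else 0))"
  proof (cases "u = w")
    case True
    have "{v \<in> neighbours E' w. vertex_degree E' v = 1}
        = insert (Suc n) {v \<in> neighbours E w. vertex_degree E v = 1}"
      using self new by (auto simp: nb dg ww split: if_splits)
    then have "leaf_count E' w = Suc (leaf_count E w)"
      unfolding leaf_count_def using new fin by simp
    then show ?thesis using True by (simp add: E'_def)
  next
    case False
    have "{v \<in> neighbours E' u. vertex_degree E' v = 1}
        = {v \<in> neighbours E u. vertex_degree E v = 1} - {w}"
      using False u new d by (auto simp: nb dg split: if_splits)
    then have "leaf_count E' u = leaf_count E u - (if w \<in> neighbours E u \<and> vertex_degree E w = 1 then 1 else 0)"
      unfolding leaf_count_def using fin by (auto simp: card_Diff_singleton_if)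
    then show ?thesis using False by (simp add: E'_def)
  qed
qed

lemma leaf_count_le_weight:
  assumes g: "grown n E"
  shows "real (leaf_count E u) \<le> weight E u"
proof -
  have "real (leaf_count E u) = (\<Sum>v | v \<in> neighbours E u \<and> vertex_degree E v = 1. 1 / real (vertex_degree E v))"
    by (simp add: leaf_count_def)
  also have "\<dots> \<le> weight E u"
    unfolding weight_def by (intro sum_mono2 finite_neighbours[OF g]) auto
  finally show ?thesis .
qed

lemma leaf_count_le_degree: "grown n E \<Longrightarrow> leaf_count E u \<le> vertex_degree E u"
  unfolding leaf_count_def vertex_degree_def by (intro card_mono finite_neighbours) auto

lemma leaf_count_outside: "grown n E \<Longrightarrow> u \<notin> {1..n} \<Longrightarrow> leaf_count E u = 0"
  using neighbours_range(2)[of n E _ u] by (metis (no_types, lifting) card.empty empty_Collect_eq leaf_count_def)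

text \<open>
  A leaf \<open>w\<close> at \<open>u\<close> has \<open>u\<close> as its only neighbour and so has weight \<open>1/d(u)\<close>. The \<open>l\<close> leaves at \<open>u\<close> together
  make a loss occur with probability \<open>l/(n d(u))\<close>, which is small compared with the probability
  of a gain when \<open>l\<close> is large.
\<close>

lemma step_mean_leaf_count:
  fixes f :: "nat \<Rightarrow> real"
  assumes g: "grown n E" and u: "u \<in> {1..n}"
  defines "l \<equiv> leaf_count E u"
  shows "step_mean n E (\<lambda>w. f (leaf_count (attach_leaf n w E) u)) =
    f l + weight E u / real n * (f (Suc l) - f l)
      + real l / (real (vertex_degree E u) * real n) * (f (l - 1) - f l)"
proof -
  define S where "S = {v \<in> neighbours E u. vertex_degree E v = 1}"
  have SS: "S \<subseteq> {1..n}" using neighbours_range(1)[OF g] by (auto simp: S_def)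
  have uS: "u \<notin> S" using neighbours_range(3)[OF g] by (auto simp: S_def)
  have wS: "weight E w = 1 / real (vertex_degree E u)" if "w \<in> S" for w
  proof -
    have "card (neighbours E w) = 1" "u \<in> neighbours E w"
      using that by (auto simp: S_def vertex_degree_def neighbours_sym)
    then have "neighbours E w = {u}" by (metis card_1_singletonE singletonD)
    then show ?thesis by (simp add: weight_def)
  qed
  have "step_mean n E (\<lambda>w. f (leaf_count (attach_leaf n w E) u))
    = step_mean n E (\<lambda>w. f l + (if w = u then f (Suc l) - f l else 0) + (if w \<in> S then f (l - 1) - f l else 0))"
    unfolding step_mean_def
    by (intro sum.cong refl) (use uS leaf_count_attach(1)[OF g _ u] in \<open>auto simp: S_def l_def\<close>)
  also have "\<dots> = f l + step_mean n E (\<lambda>w. if w = u then f (Suc l) - f l else 0)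
     + step_mean n E (\<lambda>w. if w \<in> S then f (l - 1) - f l else 0)"
    by (simp add: step_mean_add step_mean_const[OF g])
  also have "step_mean n E (\<lambda>w. if w = u then f (Suc l) - f l else 0) = weight E u / real n * (f (Suc l) - f l)"
    unfolding step_mean_def using u by (simp add: if_distrib[where f="(*) _"] cong: if_cong)
  also have "step_mean n E (\<lambda>w. if w \<in> S then f (l - 1) - f l else 0)
      = (\<Sum>w\<in>S. 1 / real (vertex_degree E u) / real n * (f (l - 1) - f l))"
    unfolding step_mean_def
    by (rule sum.mono_neutral_cong_right) (use SS wS in auto)
  also have "\<dots> = real l / (real (vertex_degree E u) * real n) * (f (l - 1) - f l)"
    by (simp add: l_def leaf_count_def S_def)
  finally show ?thesis .
qed

definition leaf_energy :: "nat \<Rightarrow> nat set set \<Rightarrow> real" where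
  "leaf_energy n E = (\<Sum>u=1..n. real (leaf_count E u) ^ 2)"

text \<open>
  For each vertex, gains contribute at least \<open>2 l\<^sup>2 + a\<close> to \<open>n\<close> times the mean change of \<open>l\<^sup>2\<close>, and losses
  cost at most \<open>2 l - 1 \<le> l\<^sup>2\<close>. What remains is \<open>l\<^sup>2 + a\<close>, and the weights \<open>a\<close> add up to \<open>n\<close>.
\<close>

lemma step_mean_leaf_energy:
  assumes g: "grown n E"
  shows "step_mean n E (\<lambda>w. leaf_energy (Suc n) (attach_leaf n w E))
    \<ge> leaf_energy n E * (1 + 1 / real n) + 1"
proof -
  have n: "real n > 0" using grown_ge_2[OF g] by simp
  have vertex: "step_mean n E (\<lambda>w. real (leaf_count (attach_leaf n w E) u) ^ 2)
      \<ge> real (leaf_count E u) ^ 2 + (real (leaf_count E u) ^ 2 + weight E u) / real n"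
    if u: "u \<in> {1..n}" for u
  proof -
    define l where "l = leaf_count E u"
    define a where "a = weight E u"
    define d where "d = real (vertex_degree E u)"
    have d: "d \<ge> 1" using degree_pos[OF g u] by (simp add: d_def)
    have ld: "real l / d \<le> 1" "real l / d \<ge> 0"
      using leaf_count_le_degree[OF g, of u] d by (auto simp: l_def d_def divide_le_eq_1)
    have la: "real l \<le> a" using leaf_count_le_weight[OF g] by (simp add: l_def a_def)
    have "real l ^ 2 \<le> a * (2 * real l) + real l / d * (real (l - 1) ^ 2 - real l ^ 2)"
    proof (cases "l = 0")
      case False
      then have e: "real (l - 1) ^ 2 - real l ^ 2 = - (2 * real l - 1)"
        by (simp add: of_nat_diff power2_eq_square algebra_simps)
      have "real l / d * (2 * real l - 1) \<le> 1 * (2 * real l - 1)"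
        using ld False by (intro mult_right_mono) auto
      moreover have "real l * (2 * real l) \<le> a * (2 * real l)" using la by (intro mult_right_mono) auto
      moreover have "(real l - 1) ^ 2 \<ge> 0" by simp
      ultimately show ?thesis unfolding e by (simp add: power2_eq_square algebra_simps)
    qed simp
    then have "(real l ^ 2 + a) / real n
      \<le> (a * (2 * real l + 1) + real l / d * (real (l - 1) ^ 2 - real l ^ 2)) / real n"
      using n by (intro divide_right_mono) (auto simp: algebra_simps)
    also have "\<dots> = a / real n * (real (Suc l) ^ 2 - real l ^ 2)
        + real l / (d * real n) * (real (l - 1) ^ 2 - real l ^ 2)"
      using n d by (simp add: field_simps power2_eq_square)
    finally show ?thesis
      unfolding step_mean_leaf_count[OF g u, of "\<lambda>x. real x ^ 2"] l_def a_def d_def by simp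
  qed
  have "leaf_energy n E * (1 + 1 / real n) + 1
     = (\<Sum>u=1..n. real (leaf_count E u) ^ 2 + (real (leaf_count E u) ^ 2 + weight E u) / real n)"
    using n sum_weight[OF g]
    by (simp add: leaf_energy_def sum.distrib sum_divide_distrib[symmetric] add_divide_distrib algebra_simps)
  also have "\<dots> \<le> (\<Sum>u=1..n. step_mean n E (\<lambda>w. real (leaf_count (attach_leaf n w E) u) ^ 2))"
    by (intro sum_mono vertex)
  also have "\<dots> = step_mean n E (\<lambda>w. \<Sum>u=1..n. real (leaf_count (attach_leaf n w E) u) ^ 2)"
    by (simp add: step_mean_sum)
  also have "\<dots> \<le> step_mean n E (\<lambda>w. leaf_energy (Suc n) (attach_leaf n w E))"
    by (intro step_mean_mono) (simp add: leaf_energy_def)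
  finally show ?thesis .
qed

text \<open>
  The shift by \<open>3\<close> makes \<open>n/(l - 3)\<close> a supermartingale despite the losses as long as \<open>l \<ge> 6\<close>, from
  where one step leads to \<open>l \<ge> 5\<close>. The value for \<open>l < 5\<close> only has to be at least \<open>1/2\<close>, so that the
  truncated potential below equals its maximum \<open>1\<close> there.
\<close>

definition leaf_potential :: "nat \<Rightarrow> real" where
  "leaf_potential l = (if l \<ge> 5 then 1 / (real l - 3) else 1)"

lemma step_mean_leaf_potential:
  assumes g: "grown n E" and l: "leaf_count E u \<ge> 6"
  shows "real (Suc n) * step_mean n E (\<lambda>w. leaf_potential (leaf_count (attach_leaf n w E) u))
    \<le> real n * leaf_potential (leaf_count E u)"
proof -
  define l where "l = real (leaf_count E u)"
  have u: "u \<in> {1..n}" using leaf_count_outside[OF g, of u] l by force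
  have n: "real n > 0" using grown_ge_2[OF g] by simp
  have l6: "l \<ge> 6" using l by (simp add: l_def)
  have d: "real (vertex_degree E u) \<ge> 1" using degree_pos[OF g u] by simp
  have ld: "l / real (vertex_degree E u) \<le> 1"
    using leaf_count_le_degree[OF g, of u] d by (auto simp: l_def divide_le_eq_1)
  have f0: "leaf_potential (leaf_count E u) = 1 / (l - 3)" using l by (simp add: leaf_potential_def l_def)
  have f1: "leaf_potential (Suc (leaf_count E u)) = 1 / (l - 2)" using l by (simp add: leaf_potential_def l_def)
  have f2: "leaf_potential (leaf_count E u - 1) = 1 / (l - 4)" using l by (auto simp add: leaf_potential_def l_def of_nat_diff)
  have "weight E u / real n * (1 / (l - 2) - 1 / (l - 3)) \<le> l / real n * (1 / (l - 2) - 1 / (l - 3))"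
  proof (intro mult_right_mono_neg divide_right_mono)
    show "l \<le> weight E u" using leaf_count_le_weight[OF g, of u] by (simp add: l_def)
    show "1 / (l - 2) - 1 / (l - 3) \<le> 0" using l6 by (simp add: frac_le)
  qed simp
  moreover have "l / (real (vertex_degree E u) * real n) * (1 / (l - 4) - 1 / (l - 3))
      \<le> 1 / real n * (1 / (l - 4) - 1 / (l - 3))"
  proof (intro mult_right_mono)
    show "l / (real (vertex_degree E u) * real n) \<le> 1 / real n"
      using divide_right_mono[OF ld, of "real n"] n by simp
  qed (use l6 in \<open>simp add: frac_le\<close>)
  moreover have "l / real n * (1 / (l - 2) - 1 / (l - 3)) + 1 / real n * (1 / (l - 4) - 1 / (l - 3))
     \<le> - (1 / real n * (1 / (l - 3)))"
  proof -
    have "l * (1 / (l - 2) - 1 / (l - 3)) + (1 / (l - 4) - 1 / (l - 3)) = - (1 / (l - 3)) - (l - 6) / ((l - 2) * (l - 3) * (l - 4))"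
    proof -
      have "l - 2 \<noteq> 0" "l - 3 \<noteq> 0" "l - 4 \<noteq> 0" using l6 by auto
      then show ?thesis by (simp add: divide_simps) (simp add: algebra_simps)
    qed
    also have "\<dots> \<le> - (1 / (l - 3))"
    proof -
      have "0 \<le> (l - 6) / ((l - 2) * (l - 3) * (l - 4))"
        using l6 by (intro divide_nonneg_nonneg mult_nonneg_nonneg) auto
      then show ?thesis by linarith
    qed
    finally have "(l * (1 / (l - 2) - 1 / (l - 3)) + (1 / (l - 4) - 1 / (l - 3))) / real n \<le> - (1 / (l - 3)) / real n"
      using n by (intro divide_right_mono) auto
    then show ?thesis by (simp add: add_divide_distrib mult.commute)
  qed
  ultimately have "step_mean n E (\<lambda>w. leaf_potential (leaf_count (attach_leaf n w E) u))
     \<le> 1 / (l - 3) - 1 / real n * (1 / (l - 3))"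
    unfolding step_mean_leaf_count[OF g u] f0 f1 f2 l_def[symmetric] by linarith
  then have "real (Suc n) * step_mean n E (\<lambda>w. leaf_potential (leaf_count (attach_leaf n w E) u))
    \<le> real (Suc n) * (1 / (l - 3) - 1 / real n * (1 / (l - 3)))" by (intro mult_left_mono) auto
  also have "\<dots> = (real n - 1 / real n) * (1 / (l - 3))"
  proof -
    have "real (Suc n) * (1 - 1 / real n) = real n - 1 / real n" using n by (simp add: field_simps)
    moreover have "1 / (l - 3) - 1 / real n * (1 / (l - 3)) = (1 - 1 / real n) * (1 / (l - 3))"
      by (simp only: left_diff_distrib mult_1_left)
    ultimately show ?thesis by (metis mult.assoc)
  qed
  also have "\<dots> \<le> real n * (1 / (l - 3))" using n l6 by (intro mult_right_mono) auto
  finally show ?thesis by (simp add: f0)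
qed

lemma leaf_count_sq_le_energy:
  assumes g: "grown n E"
  shows "real (leaf_count E u) ^ 2 \<le> degree_energy n E"
proof (cases "u \<in> {1..n}")
  case True
  have "real (leaf_count E u) ^ 2 \<le> real (vertex_degree E u) * weight E u"
    unfolding power2_eq_square
    using leaf_count_le_weight[OF g, of u] leaf_count_le_degree[OF g, of u] by (intro mult_mono) auto
  also have "\<dots> \<le> degree_energy n E"
    unfolding degree_energy_def using True
    by (intro member_le_sum) (auto simp: weight_nonneg)
  finally show ?thesis .
qed (simp add: leaf_count_outside[OF g] degree_energy_nonneg)

lemma leaf_potential_bounds:
  "leaf_potential l \<ge> 0" "l \<le> 5 \<Longrightarrow> leaf_potential l \<ge> 1 / 2"
  "l \<ge> 1 \<Longrightarrow> leaf_potential l \<ge> 1 / real l"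
  by (auto simp: leaf_potential_def frac_le)

text \<open>
  The factor \<open>2/m\<close> makes this equal to \<open>1\<close> for \<open>n \<ge> m\<close> whenever \<open>l \<le> 5\<close>. Truncation at \<open>1\<close> then gives a
  supermartingale on the whole state space, in place of stopping at the first visit to \<open>l \<le> 5\<close>.
\<close>

definition truncated_potential :: "nat \<Rightarrow> nat \<Rightarrow> nat \<Rightarrow> real" where
  "truncated_potential m n l = min 1 (2 * real n / real m * leaf_potential l)"

lemma truncated_potential_bounds: "0 \<le> truncated_potential m n l" "truncated_potential m n l \<le> 1"
  by (auto simp: truncated_potential_def leaf_potential_bounds)

lemma step_mean_truncated_potential:
  assumes g: "grown n E" and m: "0 < m" "m \<le> n"
  shows "step_mean n E (\<lambda>w. truncated_potential m (Suc n) (leaf_count (attach_leaf n w E) u))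
    \<le> truncated_potential m n (leaf_count E u)"
proof -
  let ?P = "\<lambda>w. truncated_potential m (Suc n) (leaf_count (attach_leaf n w E) u)"
  have one: "step_mean n E ?P \<le> 1"
    using step_mean_mono[of n ?P "\<lambda>_. 1" E] by (simp add: truncated_potential_bounds step_mean_const[OF g])
  show ?thesis
  proof (cases "leaf_count E u \<ge> 6")
    case True
    have "step_mean n E ?P
        \<le> step_mean n E (\<lambda>w. 2 * real (Suc n) / real m * leaf_potential (leaf_count (attach_leaf n w E) u))"
      by (intro step_mean_mono) (simp add: truncated_potential_def)
    also have "\<dots> = 2 / real m * (real (Suc n) * step_mean n E (\<lambda>w. leaf_potential (leaf_count (attach_leaf n w E) u)))"
      by (subst step_mean_cmult) simp
    also have "\<dots> \<le> 2 / real m * (real n * leaf_potential (leaf_count E u))"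
      by (intro mult_left_mono step_mean_leaf_potential[OF g True]) auto
    finally show ?thesis using one by (simp add: truncated_potential_def)
  next
    case False
    have "1 \<le> 2 * real n / real m * (1 / 2)" using m by simp
    also have "\<dots> \<le> 2 * real n / real m * leaf_potential (leaf_count E u)"
      using False by (intro mult_left_mono leaf_potential_bounds) auto
    finally show ?thesis using one by (simp add: truncated_potential_def)
  qed
qed

section \<open>Almost sure convergence of random series\<close>

text \<open>
  By monotone convergence the sum of the series has finite expectation.
\<close>

lemma nonneg_AE_summable:
  fixes f :: "nat \<Rightarrow> 'a \<Rightarrow> real"
  assumes int: "\<And>i. integrable M (f i)" and nonneg: "\<And>i. AE x in M. 0 \<le> f i x"
    and bound: "\<And>n. (\<Sum>i<n. \<integral>x. f i x \<partial>M) \<le> K"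
  shows "AE x in M. summable (\<lambda>i. f i x)"
proof -
  have [measurable]: "f i \<in> borel_measurable M" for i using int by auto
  have "(\<integral>\<^sup>+x. (\<Sum>i. ennreal (f i x)) \<partial>M) = (\<Sum>i. \<integral>\<^sup>+x. ennreal (f i x) \<partial>M)"
    by (rule nn_integral_suminf) measurable
  also have "\<dots> = (\<Sum>i. ennreal (\<integral>x. f i x \<partial>M))"
    by (intro suminf_cong nn_integral_eq_integral int nonneg)
  also have "\<dots> \<le> ennreal K"
  proof (rule suminf_le_const)
    fix n
    have "(\<Sum>i<n. ennreal (\<integral>x. f i x \<partial>M)) = ennreal (\<Sum>i<n. \<integral>x. f i x \<partial>M)"
      by (intro sum_ennreal integral_nonneg_AE nonneg)
    also have "\<dots> \<le> ennreal K" by (intro ennreal_leI bound)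
    finally show "(\<Sum>i<n. ennreal (\<integral>x. f i x \<partial>M)) \<le> ennreal K" .
  qed simp
  finally have "(\<integral>\<^sup>+x. (\<Sum>i. ennreal (f i x)) \<partial>M) \<noteq> \<infinity>" by (auto simp: top_unique)
  then have "AE x in M. (\<Sum>i. ennreal (f i x)) \<noteq> \<infinity>"
    by (intro nn_integral_PInf_AE) auto
  moreover have "AE x in M. \<forall>i. 0 \<le> f i x" using nonneg by (simp add: AE_all_countable)
  ultimately show ?thesis
  proof eventually_elim
    case (elim x)
    then show ?case by (intro summable_suminf_not_top) auto
  qed
qed

text \<open>
  The block from \<open>k\<^sup>3\<close> to \<open>(k+1)\<^sup>3\<close> has about \<open>3 k\<^sup>2\<close> terms of size \<open>O(1/k\<^sup>3)\<close>, so partial sums move by \<open>O(1/k)\<close>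
  inside a block and it is enough to control them at the cubes.
\<close>

lemma summable_from_cube_blocks:
  fixes a :: "nat \<Rightarrow> real"
  assumes bound: "\<And>i. \<bar>a i\<bar> \<le> C / real (Suc i)"
    and blocks: "summable (\<lambda>k. \<Sum>i=k^3..<(Suc k)^3. a i)"
  shows "summable a"
proof -
  define P where "P n = (\<Sum>i<n. a i)" for n
  have C: "C \<ge> 0" using bound[of 0] by simp
  have cubes: "P (k ^ 3) = (\<Sum>j<k. \<Sum>i=j^3..<(Suc j)^3. a i)" for k
  proof (induction k)
    case (Suc k)
    have "k ^ 3 \<le> Suc k ^ 3" by (intro power_mono) auto
    then have "P (Suc k ^ 3) = P (k ^ 3) + (\<Sum>i=k^3..<(Suc k)^3. a i)"
      unfolding P_def by (simp add: lessThan_atLeast0 sum.atLeastLessThan_concat)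
    then show ?case using Suc by simp
  qed (simp add: P_def)
  obtain S where S: "(\<lambda>k. P (k ^ 3)) \<longlonglongrightarrow> S"
    using blocks unfolding cubes summable_def sums_def by blast
  \<comment> \<open>The index of the block that contains \<open>n\<close>.\<close>
  define r where "r n = nat \<lfloor>root 3 (real n)\<rfloor>" for n
  have r1: "r n ^ 3 \<le> n" and r2: "n < Suc (r n) ^ 3" for n
  proof -
    have f: "real (r n) \<le> root 3 (real n)" "root 3 (real n) < real (Suc (r n))"
      unfolding r_def by (auto simp: floor_le_iff) linarith+
    have "real (r n) ^ 3 \<le> root 3 (real n) ^ 3" using f by (intro power_mono) auto
    then have "real (r n ^ 3) \<le> real n" by simp
    then show "r n ^ 3 \<le> n" by (simp only: of_nat_le_iff)
    have "root 3 (real n) ^ 3 < real (Suc (r n)) ^ 3" using f by (intro power_strict_mono) auto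
    then have "real n < real (Suc (r n) ^ 3)" by simp
    then show "n < Suc (r n) ^ 3" by (simp only: of_nat_less_iff)
  qed
  have r_lim: "filterlim r at_top sequentially"
    unfolding filterlim_at_top
  proof
    fix Z :: nat
    show "\<forall>\<^sub>F n in sequentially. Z \<le> r n"
    proof (rule eventually_sequentiallyI)
      fix n assume "Z ^ 3 \<le> n"
      then have "Z ^ 3 < Suc (r n) ^ 3" using r2 le_less_trans by blast
      then show "Z \<le> r n" using power_less_imp_less_base[of Z 3 "Suc (r n)"] by simp
    qed
  qed
  have "(\<lambda>n. P (r n ^ 3)) \<longlonglongrightarrow> S" using filterlim_compose[OF S r_lim] .
  moreover have "(\<lambda>n. P n - P (r n ^ 3)) \<longlonglongrightarrow> 0"
  proof (rule Lim_null_comparison)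
    show "\<forall>\<^sub>F n in sequentially. norm (P n - P (r n ^ 3)) \<le> 12 * C / real (Suc (r n))"
    proof (intro always_eventually allI)
      fix n
      define k where "k = r n"
      have k: "k ^ 3 \<le> n" "n < Suc k ^ 3" using r1 r2 by (auto simp: k_def)
      have "P n - P (k ^ 3) = (\<Sum>i=k^3..<n. a i)"
        using k unfolding P_def by (simp add: lessThan_atLeast0 sum_diff_nat_ivl)
      then have "norm (P n - P (k ^ 3)) \<le> (\<Sum>i=k^3..<n. \<bar>a i\<bar>)" by simp
      also have "\<dots> \<le> (\<Sum>i=k^3..<n. C / real (Suc (k ^ 3)))"
      proof (intro sum_mono order_trans[OF bound] divide_left_mono C)
        fix i assume "i \<in> {k^3..<n}"
        then show "real (Suc (k ^ 3)) \<le> real (Suc i)" by (intro of_nat_mono) auto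
        show "0 < real (Suc i) * real (Suc (k ^ 3))" by (intro mult_pos_pos of_nat_0_less_iff[THEN iffD2]) auto
      qed
      also have "\<dots> = real (n - k ^ 3) * (C / real (Suc (k ^ 3)))" by simp
      also have "\<dots> \<le> (3 * real (Suc k) ^ 2) * (C / (real (Suc k) ^ 3 / 4))"
      proof (intro mult_mono divide_left_mono)
        have "n - k ^ 3 \<le> Suc k ^ 3 - k ^ 3" using k by simp
        also have "\<dots> \<le> 3 * Suc k ^ 2" by (simp add: power3_eq_cube power2_eq_square algebra_simps)
        finally have "real (n - k ^ 3) \<le> real (3 * Suc k ^ 2)" by (rule of_nat_mono)
        then show "real (n - k ^ 3) \<le> 3 * real (Suc k) ^ 2" by simp
        have "0 \<le> 3 * (real k + 1) * (real k - 1) ^ 2" by simp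
        then show "real (Suc k) ^ 3 / 4 \<le> real (Suc (k ^ 3))"
          by (simp add: power3_eq_cube power2_eq_square algebra_simps)
      qed (use C in \<open>auto intro!: mult_pos_pos zero_less_power add_pos_nonneg\<close>)
      also have "\<dots> = 12 * C / real (Suc k)"
        by (simp add: power3_eq_cube power2_eq_square del: of_nat_Suc)
      finally show "norm (P n - P (r n ^ 3)) \<le> 12 * C / real (Suc (r n))" by (simp add: k_def)
    qed
    have "(\<lambda>k. 12 * C * inverse (real (Suc k))) \<longlonglongrightarrow> 12 * C * 0"
      by (intro tendsto_mult tendsto_const LIMSEQ_inverse_real_of_nat)
    from filterlim_compose[OF this r_lim]
    show "(\<lambda>n. 12 * C / real (Suc (r n))) \<longlonglongrightarrow> 0" by (simp add: divide_inverse)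
  qed
  ultimately have "(\<lambda>n. (P n - P (r n ^ 3)) + P (r n ^ 3)) \<longlonglongrightarrow> 0 + S" by (intro tendsto_add)
  then show ?thesis unfolding summable_def sums_def P_def by auto
qed

text \<open>
  By orthogonality the square of the block sum \<open>R\<close> from \<open>k\<^sup>3\<close> to \<open>(k+1)\<^sup>3\<close> has mean \<open>O(1/k\<^sup>4)\<close>, so that
  \<open>k\<^sup>2 R\<^sup>2\<close> is summable almost surely, and \<open>|R| \<le> 1/k\<^sup>2 + k\<^sup>2 R\<^sup>2\<close> by the inequality of arithmetic and
  geometric means. Cubes leave enough room on both sides: with squares instead of cubes the mean of
  \<open>R\<^sup>2\<close> would be of order \<open>1/k\<^sup>3\<close>, which would require half-integral powers here.
\<close>

lemma (in prob_space) orthogonal_AE_summable: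
  fixes N :: "nat \<Rightarrow> 'a \<Rightarrow> real"
  assumes meas [measurable]: "\<And>i. N i \<in> borel_measurable M"
    and bound: "\<And>i. AE x in M. \<bar>N i x\<bar> \<le> C / real (Suc i)"
    and orth: "\<And>i j. i < j \<Longrightarrow> expectation (\<lambda>x. N i x * N j x) = 0"
  shows "AE x in M. summable (\<lambda>i. N i x)"
proof -
  have C: "C \<ge> 0"
  proof -
    from bound[of 0] have "AE x in M. C \<ge> 0" by eventually_elim auto
    then show ?thesis by simp
  qed
  have prod_bound: "AE x in M. \<bar>N i x * N j x\<bar> \<le> C / real (Suc i) * (C / real (Suc j))" for i j
    using bound[of i] bound[of j] unfolding abs_mult by eventually_elim (intro mult_mono, auto)
  have int: "integrable M (\<lambda>x. N i x * N j x)" for i j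
    by (rule integrable_const_bound[OF _ borel_measurable_times[OF meas meas]])
      (use prod_bound[of i j] in auto)
  define R where "R k x = (\<Sum>i=k^3..<(Suc k)^3. N i x)" for k x
  have R_sq: "(R k x)^2 = (\<Sum>i=k^3..<(Suc k)^3. \<Sum>j=k^3..<(Suc k)^3. N i x * N j x)" for k x
    by (simp add: R_def power2_eq_square sum_product)
  have int_R: "integrable M (\<lambda>x. (R k x)^2)" for k
    unfolding R_sq by (intro Bochner_Integration.integrable_sum int)
  have E_R: "expectation (\<lambda>x. (R k x)^2) \<le> 48 * C^2 / real (Suc k) ^ 4" for k
  proof -
    have "expectation (\<lambda>x. (R k x)^2)
        = (\<Sum>i=k^3..<(Suc k)^3. \<Sum>j=k^3..<(Suc k)^3. expectation (\<lambda>x. N i x * N j x))"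
      unfolding R_sq by (simp add: int)
    also have "\<dots> = (\<Sum>i=k^3..<(Suc k)^3. \<Sum>j=k^3..<(Suc k)^3. if i = j then expectation (\<lambda>x. N i x * N i x) else 0)"
    proof (intro sum.cong refl)
      fix i j
      show "expectation (\<lambda>x. N i x * N j x) = (if i = j then expectation (\<lambda>x. N i x * N i x) else 0)"
        using orth[of i j] orth[of j i] by (cases i j rule: linorder_cases) (auto simp: mult.commute)
    qed
    also have "\<dots> = (\<Sum>i=k^3..<(Suc k)^3. expectation (\<lambda>x. N i x * N i x))" by simp
    also have "\<dots> \<le> (\<Sum>i=k^3..<(Suc k)^3. (C / (real (Suc k) ^ 3 / 4)) ^ 2)"
    proof (intro sum_mono)
      fix i assume i: "i \<in> {k^3..<Suc k ^ 3}"
      have "expectation (\<lambda>x. N i x * N i x) \<le> expectation (\<lambda>x. C / real (Suc i) * (C / real (Suc i)))"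
        by (intro integral_mono_AE int) (use prod_bound[of i i] in auto)
      also have "\<dots> = (C / real (Suc i))^2" by (simp add: prob_space power2_eq_square)
      also have "\<dots> \<le> (C / (real (Suc k) ^ 3 / 4)) ^ 2"
      proof (intro power_mono divide_left_mono)
        have "0 \<le> 3 * (real k + 1) * (real k - 1) ^ 2" by simp
        then have "real (Suc k) ^ 3 / 4 \<le> real (Suc (k ^ 3))"
          by (simp add: power3_eq_cube power2_eq_square algebra_simps)
        also have "\<dots> \<le> real (Suc i)" using i by (intro of_nat_mono) auto
        finally show "real (Suc k) ^ 3 / 4 \<le> real (Suc i)" .
      qed (use C in auto)
      finally show "expectation (\<lambda>x. N i x * N i x) \<le> (C / (real (Suc k) ^ 3 / 4)) ^ 2" .
    qed
    also have "\<dots> = real (Suc k ^ 3 - k ^ 3) * (C / (real (Suc k) ^ 3 / 4)) ^ 2" by simp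
    also have "\<dots> \<le> 3 * real (Suc k) ^ 2 * (C / (real (Suc k) ^ 3 / 4)) ^ 2"
    proof (intro mult_right_mono)
      have "Suc k ^ 3 - k ^ 3 \<le> 3 * Suc k ^ 2" by (simp add: power3_eq_cube power2_eq_square algebra_simps)
      then have "real (Suc k ^ 3 - k ^ 3) \<le> real (3 * Suc k ^ 2)" by (rule of_nat_mono)
      then show "real (Suc k ^ 3 - k ^ 3) \<le> 3 * real (Suc k) ^ 2" by simp
    qed simp
    also have "\<dots> = 48 * C^2 / real (Suc k) ^ 4"
    proof -
      define s where "s = real (Suc k)"
      have "s \<noteq> 0" by (simp add: s_def)
      then show ?thesis unfolding s_def[symmetric]
        by (simp add: divide_simps power2_eq_square power3_eq_cube power4_eq_xxxx)
    qed
    finally show ?thesis .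
  qed
  have inv_sq: "summable (\<lambda>k. 1 / real (Suc k) ^ 2)"
    using inverse_squares_sums unfolding summable_def by (auto simp: add.commute)
  have "AE x in M. summable (\<lambda>k. real (Suc k) ^ 2 * (R k x)^2)"
  proof (rule nonneg_AE_summable)
    fix n
    have "(\<Sum>k<n. expectation (\<lambda>x. real (Suc k) ^ 2 * (R k x)^2)) \<le> (\<Sum>k<n. 48 * C^2 * (1 / real (Suc k) ^ 2))"
    proof (intro sum_mono)
      fix k
      have "real (Suc k) ^ 2 * expectation (\<lambda>x. (R k x)^2) \<le> real (Suc k) ^ 2 * (48 * C^2 / real (Suc k) ^ 4)"
        by (intro mult_left_mono E_R) auto
      also have "\<dots> = 48 * C^2 * (1 / real (Suc k) ^ 2)" 
        by (simp add: power2_eq_square power4_eq_xxxx del: of_nat_Suc)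
      finally show "expectation (\<lambda>x. real (Suc k) ^ 2 * (R k x)^2) \<le> 48 * C^2 * (1 / real (Suc k) ^ 2)" by simp
    qed
    also have "\<dots> \<le> (\<Sum>k. 48 * C^2 * (1 / real (Suc k) ^ 2))"
      by (intro sum_le_suminf summable_mult inv_sq) auto
    finally show "(\<Sum>k<n. expectation (\<lambda>x. real (Suc k) ^ 2 * (R k x)^2)) \<le> (\<Sum>k. 48 * C^2 * (1 / real (Suc k) ^ 2))" .
  qed (use int_R in auto)
  moreover have "AE x in M. \<forall>i. \<bar>N i x\<bar> \<le> C / real (Suc i)" using bound by (simp add: AE_all_countable)
  ultimately show ?thesis
  proof eventually_elim
    case (elim x)
    have "summable (\<lambda>k. R k x)"
    proof (rule summable_comparison_test'[of "\<lambda>k. 1 / real (Suc k) ^ 2 + real (Suc k) ^ 2 * (R k x)^2"])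
      show "summable (\<lambda>k. 1 / real (Suc k) ^ 2 + real (Suc k) ^ 2 * (R k x)^2)"
        by (intro summable_add inv_sq elim)
      fix k
      define s where "s = real (Suc k)"
      have s: "s > 0" by (simp add: s_def)
      \<comment> \<open>The inequality of arithmetic and geometric means for \<open>1/s\<^sup>2\<close> and \<open>s\<^sup>2 R\<^sup>2\<close>.\<close>
      have "0 \<le> (1 / s - s * \<bar>R k x\<bar>) ^ 2" by simp
      also have "\<dots> = 1 / s ^ 2 + s ^ 2 * (R k x) ^ 2 - 2 * \<bar>R k x\<bar>"
        using s by (simp add: power2_diff power_mult_distrib power_divide)
      finally show "norm (R k x) \<le> 1 / real (Suc k) ^ 2 + real (Suc k) ^ 2 * (R k x)^2"
        unfolding s_def[symmetric] by simp
    qed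
    then show ?case
      using elim by (intro summable_from_cube_blocks[of "\<lambda>i. N i x" C, folded R_def]) auto
  qed
qed

section \<open>Discrete sigma-algebras\<close>

lemma measurable_restrict_count_space:
  "X \<in> measurable M (count_space UNIV) \<Longrightarrow> X \<in> space M \<rightarrow> C \<Longrightarrow> X \<in> measurable M (count_space C)"
  unfolding measurable_def by auto

text \<open>
  On an uncountable type, tuples of variables that are measurable for the discrete
  sigma-algebra need not be measurable for it again; countable ranges repair this.
\<close>

lemma measurable_map_count_space:
  assumes "countable C"
    and "\<And>k. k \<in> set ks \<Longrightarrow> X k \<in> measurable M (count_space UNIV)"
    and "\<And>k. k \<in> set ks \<Longrightarrow> X k \<in> space M \<rightarrow> C"
  shows "(\<lambda>x. map (\<lambda>k. X k x) ks) \<in> measurable M (count_space UNIV)"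
  using assms(2,3)
proof (induction ks)
  case (Cons k ks)
  have "(\<lambda>x. X k x # map (\<lambda>k. X k x) ks) \<in> measurable M (count_space UNIV)"
  proof (rule measurable_compose_countable'[OF _ _ assms(1), where g = "X k" and f = "\<lambda>t x. t # map (\<lambda>k. X k x) ks"])
    show "(\<lambda>x. t # map (\<lambda>k. X k x) ks) \<in> measurable M (count_space UNIV)" for t
      by (rule measurable_compose[where N = "count_space UNIV", OF Cons.IH]) (use Cons.prems in auto)
    show "X k \<in> measurable M (count_space C)"
      by (rule measurable_restrict_count_space) (use Cons.prems in auto)
  qed
  then show ?case by simp
qed simp

lemma subalgebra_sigma_of:
  assumes "X \<in> measurable M (count_space UNIV)"
  shows "subalgebra M (sigma_of M X)"
  unfolding subalgebra_def sigma_of_def using measurable_sets[OF assms]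
  by (auto simp: sets_vimage_algebra2)

lemma sets_sigma_of: "sets (sigma_of M X) = {X -` B \<inter> space M | B. True}"
  unfolding sigma_of_def by (simp add: sets_vimage_algebra2)

text \<open>
  For a sigma-algebra generated by a discrete variable, measurability means being constant on
  the fibres, so it can be verified pointwise.
\<close>

lemma measurable_sigma_of:
  fixes h :: "'a \<Rightarrow> real"
  assumes "\<And>x y. x \<in> space M \<Longrightarrow> y \<in> space M \<Longrightarrow> X x = X y \<Longrightarrow> h x = h y"
  shows "h \<in> borel_measurable (sigma_of M X)"
proof -
  \<comment> \<open>A factor of \<open>h\<close> through \<open>X\<close>; the chosen representative does not matter.\<close>
  define g where "g p = h (SOME x. x \<in> space M \<and> X x = p)" for p
  have sp: "space (sigma_of M X) = space M" by (simp add: sigma_of_def)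
  have "g (X x) = h x" if "x \<in> space M" for x
    unfolding g_def
    by (rule someI2[of "\<lambda>y. y \<in> space M \<and> X y = X x" x]) (use that in \<open>blast intro: assms\<close>)+
  moreover have "X \<in> measurable (sigma_of M X) (count_space UNIV)"
    unfolding sigma_of_def by (rule measurable_vimage_algebra1) simp
  then have "(\<lambda>x. g (X x)) \<in> borel_measurable (sigma_of M X)"
    by (rule measurable_compose) simp
  ultimately show ?thesis by (subst measurable_cong[where g = "\<lambda>x. g (X x)"]) (auto simp: sp)
qed

section \<open>The law of one step\<close>

context random_friend_tree
begin

text \<open>
  Adaptedness in the pointwise form that suffices for a discrete filtration.
\<close>

definition past_determined :: "nat \<Rightarrow> ('a \<Rightarrow> real) \<Rightarrow> bool" where
  "past_determined n f \<longleftrightarrow>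
    (\<forall>x\<in>space M. \<forall>y\<in>space M. past T V W n x = past T V W n y \<longrightarrow> f x = f y)"

lemma past_eq_T: "past T V W n x = past T V W n y \<Longrightarrow> 2 \<le> m \<Longrightarrow> m \<le> n \<Longrightarrow> T m x = T m y"
  by (auto simp: past_def simp del: upt_Suc)

lemma finite_T: "n \<ge> 2 \<Longrightarrow> \<omega> \<in> space M \<Longrightarrow> finite (T n \<omega>) \<and> (\<forall>e\<in>T n \<omega>. finite e)"
  by (induction n rule: dec_induct) (auto simp: T_2 T_Suc)

lemma T_range: "\<exists>C. countable C \<and> (\<forall>n\<ge>2. T n \<in> space M \<rightarrow> C)"
proof (intro exI conjI allI impI)
  show "countable {E :: nat set set. finite E \<and> E \<subseteq> {e. finite e}}"
    by (intro countable_Collect_finite_subset) (use countable_Collect_finite_subset[of "UNIV :: nat set"] in simp)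
  show "T n \<in> space M \<rightarrow> {E. finite E \<and> E \<subseteq> {e. finite e}}" if "n \<ge> 2" for n
    using finite_T[OF that] by auto
qed

text \<open>
  Needed to know that conditioning on the past is conditioning on a sub-sigma-algebra; otherwise
  the conditional expectations in the two laws would carry no information.
\<close>

lemma past_measurable: "past T V W n \<in> measurable M (count_space UNIV)"
proof -
  obtain C where C: "countable C" "\<And>n. n \<ge> 2 \<Longrightarrow> T n \<in> space M \<rightarrow> C" using T_range by blast
  have trees: "(\<lambda>\<omega>. map (\<lambda>k. T k \<omega>) [2..<Suc n]) \<in> measurable M (count_space UNIV)"
    by (rule measurable_map_count_space[OF C(1)]) (use C(2) T_measurable in auto)
  have steps: "(\<lambda>\<omega>. map (\<lambda>k. (V k \<omega>, W k \<omega>)) [2..<n]) \<in> measurable M (count_space UNIV)"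
  proof (rule measurable_map_count_space[where C = UNIV])
    fix k assume "k \<in> set [2..<n]"
    then have [measurable]: "V k \<in> measurable M (count_space UNIV)" "W k \<in> measurable M (count_space UNIV)"
      using V_measurable W_measurable by auto
    show "(\<lambda>\<omega>. (V k \<omega>, W k \<omega>)) \<in> measurable M (count_space UNIV)"
      by measurable
  qed auto
  show ?thesis unfolding past_def
    by (rule measurable_compose_countable[OF _ steps, where f = "\<lambda>i \<omega>. (map (\<lambda>k. T k \<omega>) [2..<Suc n], i)"])
      (rule measurable_compose[OF trees], simp)
qed

lemma past_V_measurable:
  assumes "n \<ge> 2"
  shows "(\<lambda>\<omega>. (past T V W n \<omega>, V n \<omega>)) \<in> measurable M (count_space UNIV)"
  by (rule measurable_compose_countable[OF _ V_measurable[OF assms], where f = "\<lambda>i \<omega>. (past T V W n \<omega>, i)"])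
    (rule measurable_compose[OF past_measurable], simp)

lemma finite_measure_subalgebra_sigma_of:
  assumes "X \<in> measurable M (count_space UNIV)"
  shows "finite_measure_subalgebra M (sigma_of M X)"
  by (intro finite_measure_subalgebra.intro finite_measure_subalgebra_axioms.intro
      subalgebra_sigma_of[OF assms] finite_measure_axioms)

lemma past_determined_measurable:
  assumes "past_determined n f"
  shows "f \<in> borel_measurable (sigma_of M (past T V W n))" "f \<in> borel_measurable M"
    "f \<in> borel_measurable (sigma_of M (\<lambda>\<omega>. (past T V W n \<omega>, V n \<omega>)))"
proof -
  show 1: "f \<in> borel_measurable (sigma_of M (past T V W n))"
    using assms by (intro measurable_sigma_of) (unfold past_determined_def, blast)
  show "f \<in> borel_measurable M"
    using measurable_from_subalg[OF subalgebra_sigma_of[OF past_measurable] 1] .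
  show "f \<in> borel_measurable (sigma_of M (\<lambda>\<omega>. (past T V W n \<omega>, V n \<omega>)))"
    using assms by (intro measurable_sigma_of) (unfold past_determined_def prod.inject, blast)
qed

lemma V_event: "n \<ge> 2 \<Longrightarrow> {\<omega>\<in>space M. V n \<omega> = v} \<in> sets M"
  using measurable_sets[OF V_measurable, of n "{v}"] by (simp add: vimage_def Int_def conj_commute)

lemma W_event: "n \<ge> 2 \<Longrightarrow> {\<omega>\<in>space M. W n \<omega> = w} \<in> sets M"
  using measurable_sets[OF W_measurable, of n "{w}"] by (simp add: vimage_def Int_def conj_commute)

lemma V_step:
  assumes n: "n \<ge> 2" and f: "past_determined n f" "integrable M f"
  shows "expectation (\<lambda>\<omega>. f \<omega> * indicator {\<omega>\<in>space M. V n \<omega> = v} \<omega>)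
    = expectation (\<lambda>\<omega>. f \<omega> * pmf (pmf_of_set {1..n}) v)"
proof -
  interpret F: finite_measure_subalgebra M "sigma_of M (past T V W n)"
    by (rule finite_measure_subalgebra_sigma_of[OF past_measurable])
  have ev [measurable]: "{\<omega>\<in>space M. V n \<omega> = v} \<in> sets M"
    using V_event[OF n] .
  have "expectation (\<lambda>\<omega>. f \<omega> * indicator {\<omega>\<in>space M. V n \<omega> = v} \<omega>)
    = expectation (\<lambda>\<omega>. f \<omega> * real_cond_exp M (sigma_of M (past T V W n)) (indicator {\<omega>\<in>space M. V n \<omega> = v}) \<omega>)"
    by (rule F.real_cond_exp_intg(2)[symmetric])
      (use f past_determined_measurable[OF f(1)] integrable_real_mult_indicator[OF ev f(2)] in auto)
  also have "\<dots> = expectation (\<lambda>\<omega>. f \<omega> * pmf (pmf_of_set {1..n}) v)"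
    by (rule integral_cong_AE)
      (use V_law[OF n, of v] past_determined_measurable(2)[OF f(1)] in auto)
  finally show ?thesis .
qed

lemma V_range: 
  assumes n: "n \<ge> 2"
  shows "AE \<omega> in M. V n \<omega> \<in> {1..n}"
proof -
  have "AE \<omega> in M. V n \<omega> \<noteq> v" if v: "v \<notin> {1..n}" for v
  proof -
    have ev: "{\<omega>\<in>space M. V n \<omega> = v} \<in> sets M"
      using V_event[OF n] .
    have "expectation (\<lambda>\<omega>. 1 * indicator {\<omega>\<in>space M. V n \<omega> = v} \<omega>) = (0::real)"
      using v n V_step[OF n, of "\<lambda>_. 1" v] by (simp add: past_determined_def)
    then have "prob {\<omega>\<in>space M. V n \<omega> = v} = 0" using ev by simp
    then show ?thesis using ev by (simp add: AE_iff_measurable[OF _ refl] emeasure_eq_measure)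
  qed
  then have "AE \<omega> in M. \<forall>v. v \<notin> {1..n} \<longrightarrow> V n \<omega> \<noteq> v" unfolding AE_all_countable by auto
  then show ?thesis by eventually_elim auto
qed

lemma sum_neighbour_pmf:
  assumes g: "grown n E"
  shows "(\<Sum>v=1..n. pmf (pmf_of_set (neighbours E v)) w) = weight E w"
proof -
  have "(\<Sum>v=1..n. pmf (pmf_of_set (neighbours E v)) w)
      = (\<Sum>v=1..n. if v \<in> neighbours E w then 1 / real (vertex_degree E v) else 0)"
  proof (intro sum.cong refl)
    fix v assume "v \<in> {1..n}"
    then show "pmf (pmf_of_set (neighbours E v)) w = (if v \<in> neighbours E w then 1 / real (vertex_degree E v) else 0)"
      using neighbours_nonempty[OF g] finite_neighbours[OF g]
      by (simp add: pmf_of_set vertex_degree_def neighbours_sym[of v E w] indicator_def)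
  qed
  also have "\<dots> = weight E w"
    unfolding weight_def
    by (rule sum.mono_neutral_cong_right) (use neighbours_range(1)[OF g] in auto)
  finally show ?thesis .
qed

text \<open>
  Condition first on the past together with \<open>V n\<close>, then on the past alone. Averaging the uniform law
  on the neighbours of \<open>v\<close> over uniform \<open>v\<close> gives \<open>weight/n\<close>. That the tree is well formed is assumed here,
  because it is in turn derived from this lemma in an induction over \<open>n\<close>.
\<close>

lemma W_step:
  assumes n: "n \<ge> 2" and g: "AE \<omega> in M. grown n (T n \<omega>)"
    and f: "past_determined n f" "integrable M f"
  shows "expectation (\<lambda>\<omega>. f \<omega> * indicator {\<omega>\<in>space M. W n \<omega> = w} \<omega>)
    = expectation (\<lambda>\<omega>. weight (T n \<omega>) w / real n * f \<omega>)"
    and "integrable M (\<lambda>\<omega>. weight (T n \<omega>) w / real n * f \<omega>)"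
proof -
  define G where "G = sigma_of M (\<lambda>\<omega>. (past T V W n \<omega>, V n \<omega>))"
  define q where "q v \<omega> = pmf (pmf_of_set (neighbours (T n \<omega>) v)) w" for v \<omega>
  interpret G: finite_measure_subalgebra M G
    unfolding G_def by (rule finite_measure_subalgebra_sigma_of[OF past_V_measurable[OF n]])
  have ev [measurable]: "{\<omega>\<in>space M. W n \<omega> = w} \<in> sets M" "{\<omega>\<in>space M. V n \<omega> = v} \<in> sets M" for v
    using W_event[OF n] V_event[OF n] .
  have pT: "T n x = T n y" if "past T V W n x = past T V W n y" for x y
    using past_eq_T[OF that, of n] n by simp
  have fq: "past_determined n (\<lambda>\<omega>. f \<omega> * q v \<omega>)" for v
    using f(1) pT unfolding past_determined_def q_def by metis
  have fm [measurable]: "f \<in> borel_measurable M" using past_determined_measurable(2)[OF f(1)] .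
  have ifq: "integrable M (\<lambda>\<omega>. f \<omega> * q v \<omega>)" for v
    by (rule Bochner_Integration.integrable_bound[OF f(2) past_determined_measurable(2)[OF fq]])
      (auto simp: q_def abs_mult pmf_le_1 mult_left_le)
  have [measurable]: "V n \<in> measurable M (count_space UNIV)" using V_measurable[OF n] .
  have fqV: "(\<lambda>\<omega>. f \<omega> * q (V n \<omega>) \<omega>) \<in> borel_measurable M"
    by (rule measurable_compose_countable[OF past_determined_measurable(2)[OF fq]]) measurable
  have "expectation (\<lambda>\<omega>. f \<omega> * indicator {\<omega>\<in>space M. W n \<omega> = w} \<omega>)
    = expectation (\<lambda>\<omega>. f \<omega> * real_cond_exp M G (indicator {\<omega>\<in>space M. W n \<omega> = w}) \<omega>)"
    by (rule G.real_cond_exp_intg(2)[symmetric])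
      (use f past_determined_measurable[OF f(1)] integrable_real_mult_indicator[OF ev(1) f(2)]
        in \<open>auto simp: G_def\<close>)
  also have "\<dots> = expectation (\<lambda>\<omega>. f \<omega> * q (V n \<omega>) \<omega>)"
    by (rule integral_cong_AE) (use W_law[OF n, of w] fqV in \<open>auto simp: G_def q_def\<close>)
  also have "\<dots> = expectation (\<lambda>\<omega>. \<Sum>v=1..n. f \<omega> * q v \<omega> * indicator {\<omega>\<in>space M. V n \<omega> = v} \<omega>)"
  proof (rule integral_cong_AE[OF fqV])
    show "(\<lambda>\<omega>. \<Sum>v=1..n. f \<omega> * q v \<omega> * indicator {\<omega>\<in>space M. V n \<omega> = v} \<omega>) \<in> borel_measurable M"
      using past_determined_measurable(2)[OF fq] by measurable
    show "AE \<omega> in M. f \<omega> * q (V n \<omega>) \<omega> = (\<Sum>v=1..n. f \<omega> * q v \<omega> * indicator {\<omega>\<in>space M. V n \<omega> = v} \<omega>)"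
      using V_range[OF n] AE_space
    proof eventually_elim
      case (elim \<omega>)
      have "(\<Sum>v=1..n. f \<omega> * q v \<omega> * indicator {\<omega>\<in>space M. V n \<omega> = v} \<omega>)
          = (\<Sum>v=1..n. if v = V n \<omega> then f \<omega> * q v \<omega> else 0)"
        using elim by (intro sum.cong) auto
      then show ?case using elim by simp
    qed
  qed
  also have "\<dots> = (\<Sum>v=1..n. expectation (\<lambda>\<omega>. f \<omega> * q v \<omega> * indicator {\<omega>\<in>space M. V n \<omega> = v} \<omega>))"
    by (rule Bochner_Integration.integral_sum) (rule integrable_real_mult_indicator[OF ev(2) ifq])
  also have "\<dots> = (\<Sum>v=1..n. expectation (\<lambda>\<omega>. f \<omega> * q v \<omega> * (1 / real n)))"
    using V_step[OF n fq ifq] n by (intro sum.cong) (auto simp: pmf_of_set)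
  also have "\<dots> = expectation (\<lambda>\<omega>. \<Sum>v=1..n. f \<omega> * q v \<omega> * (1 / real n))"
    by (rule Bochner_Integration.integral_sum[symmetric]) (use ifq in simp)
  also have "\<dots> = expectation (\<lambda>\<omega>. weight (T n \<omega>) w / real n * f \<omega>) \<and>
      integrable M (\<lambda>\<omega>. weight (T n \<omega>) w / real n * f \<omega>)"
  proof -
    have eq: "AE \<omega> in M. (\<Sum>v=1..n. f \<omega> * q v \<omega> * (1 / real n)) = weight (T n \<omega>) w / real n * f \<omega>"
      using g
    proof eventually_elim
      case (elim \<omega>)
      show ?case unfolding sum_neighbour_pmf[OF elim, of w, symmetric] q_def
        by (simp add: sum_distrib_left sum_distrib_right sum_divide_distrib mult.commute)
    qed
    have m: "(\<lambda>\<omega>. weight (T n \<omega>) w / real n * f \<omega>) \<in> borel_measurable M"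
      by (rule past_determined_measurable(2)[of n]) (use f(1) pT in \<open>unfold past_determined_def, metis\<close>)
    have i: "integrable M (\<lambda>\<omega>. \<Sum>v=1..n. f \<omega> * q v \<omega> * (1 / real n))"
      by (rule Bochner_Integration.integrable_sum) (use ifq in simp)
    show ?thesis
      using integral_cong_AE[OF borel_measurable_integrable[OF i] m eq] 
        integrable_cong_AE_imp[OF i m] eq by auto
  qed
  finally show "expectation (\<lambda>\<omega>. f \<omega> * indicator {\<omega>\<in>space M. W n \<omega> = w} \<omega>)
    = expectation (\<lambda>\<omega>. weight (T n \<omega>) w / real n * f \<omega>)"
    and "integrable M (\<lambda>\<omega>. weight (T n \<omega>) w / real n * f \<omega>)" by auto
qed

lemma W_range_if_grown:
  assumes n: "n \<ge> 2" and g: "AE \<omega> in M. grown n (T n \<omega>)"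
  shows "AE \<omega> in M. W n \<omega> \<in> {1..n}"
proof -
  have "AE \<omega> in M. W n \<omega> \<noteq> w" if w: "w \<notin> {1..n}" for w
  proof -
    have ev: "{\<omega>\<in>space M. W n \<omega> = w} \<in> sets M"
      using W_event[OF n] .
    have "expectation (\<lambda>\<omega>. 1 * indicator {\<omega>\<in>space M. W n \<omega> = w} \<omega>)
        = expectation (\<lambda>\<omega>. weight (T n \<omega>) w / real n * 1)"
      by (rule W_step[OF n g]) (auto simp: past_determined_def)
    also have "\<dots> = 0"
    proof (rule integral_eq_zero_AE)
      show "AE \<omega> in M. weight (T n \<omega>) w / real n * 1 = 0"
        using g
      proof eventually_elim
        case (elim \<omega>)
        have "neighbours (T n \<omega>) w = {}" using neighbours_range(2)[OF elim] w by blast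
        then show ?case by (simp add: weight_def)
      qed
    qed
    finally have "prob {\<omega>\<in>space M. W n \<omega> = w} = 0" using ev by simp
    then show ?thesis using ev by (simp add: AE_iff_measurable[OF _ refl] emeasure_eq_measure)
  qed
  then have "AE \<omega> in M. \<forall>w. w \<notin> {1..n} \<longrightarrow> W n \<omega> \<noteq> w" unfolding AE_all_countable by auto
  then show ?thesis by eventually_elim auto
qed

lemma T_grown: "n \<ge> 2 \<Longrightarrow> AE \<omega> in M. grown n (T n \<omega>)"
proof (induction n rule: dec_induct)
  case base
  show ?case using AE_space by eventually_elim (simp add: T_2 grown.edge[simplified])
next
  case (step n)
  show ?case
    using step.IH W_range_if_grown[OF step.hyps(1) step.IH] AE_space
    by eventually_elim (use step.hyps in \<open>auto simp: T_Suc intro!: grown.attach\<close>)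
qed

lemmas W_range = W_range_if_grown[OF _ T_grown]

text \<open>
  Every conditional mean computed below comes from this formula, in which \<open>h\<close> may depend on the whole past.
\<close>

lemma one_step:
  fixes h :: "nat \<Rightarrow> 'a \<Rightarrow> real"
  assumes n: "n \<ge> 2" and det: "\<And>w. past_determined n (h w)" and int: "\<And>w. integrable M (h w)"
  shows "integrable M (\<lambda>\<omega>. h (W n \<omega>) \<omega>)"
    and "expectation (\<lambda>\<omega>. h (W n \<omega>) \<omega>) = expectation (\<lambda>\<omega>. step_mean n (T n \<omega>) (\<lambda>w. h w \<omega>))"
proof -
  have ev: "{\<omega>\<in>space M. W n \<omega> = w} \<in> sets M" for w
    using W_event[OF n] .
  have m: "(\<lambda>\<omega>. h (W n \<omega>) \<omega>) \<in> borel_measurable M"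
    using past_determined_measurable(2)[OF det] W_measurable[OF n] by (rule measurable_compose_countable)
  define S where "S \<omega> = (\<Sum>w=1..n. h w \<omega> * indicator {\<omega>\<in>space M. W n \<omega> = w} \<omega>)" for \<omega>
  have iS: "integrable M S" unfolding S_def
    by (intro Bochner_Integration.integrable_sum integrable_real_mult_indicator ev int)
  have eq: "AE \<omega> in M. S \<omega> = h (W n \<omega>) \<omega>"
    using W_range[OF n n] AE_space
  proof eventually_elim
    case (elim \<omega>)
    have "S \<omega> = (\<Sum>w=1..n. if w = W n \<omega> then h w \<omega> else 0)"
      unfolding S_def using elim by (intro sum.cong) auto
    then show ?case using elim by simp
  qed
  show "integrable M (\<lambda>\<omega>. h (W n \<omega>) \<omega>)" by (rule integrable_cong_AE_imp[OF iS m eq])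
  have "expectation (\<lambda>\<omega>. h (W n \<omega>) \<omega>) = expectation S"
    by (rule integral_cong_AE[OF m borel_measurable_integrable[OF iS]]) (use eq in auto)
  also have "\<dots> = (\<Sum>w=1..n. expectation (\<lambda>\<omega>. h w \<omega> * indicator {\<omega>\<in>space M. W n \<omega> = w} \<omega>))"
    unfolding S_def by (intro Bochner_Integration.integral_sum integrable_real_mult_indicator ev int)
  also have "\<dots> = (\<Sum>w=1..n. expectation (\<lambda>\<omega>. weight (T n \<omega>) w / real n * h w \<omega>))"
    by (intro sum.cong refl W_step n T_grown det int)
  also have "\<dots> = expectation (\<lambda>\<omega>. step_mean n (T n \<omega>) (\<lambda>w. h w \<omega>))"
    unfolding step_mean_def
    by (rule Bochner_Integration.integral_sum[symmetric]) (intro W_step n T_grown det int)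
  finally show "expectation (\<lambda>\<omega>. h (W n \<omega>) \<omega>) = expectation (\<lambda>\<omega>. step_mean n (T n \<omega>) (\<lambda>w. h w \<omega>))" .
qed

text \<open>
  \<open>T n\<close> takes only finitely many values almost surely, so integrability is never an issue.
\<close>

lemma T_fun_bounded:
  fixes f :: "nat set set \<Rightarrow> real"
  assumes n: "n \<ge> 2"
  shows "\<exists>K. AE \<omega> in M. \<bar>f (T n \<omega>)\<bar> \<le> K"
proof -
  have "AE \<omega> in M. \<bar>f (T n \<omega>)\<bar> \<le> Max ((\<lambda>E. \<bar>f E\<bar>) ` {E. grown n E})"
    using T_grown[OF n] by eventually_elim (auto intro!: Max_ge simp: finite_grown)
  then show ?thesis ..
qed

lemma integrable_mult_T_fun:
  assumes n: "n \<ge> 2" and Z: "Z \<in> borel_measurable M" "AE \<omega> in M. \<bar>Z \<omega>\<bar> \<le> K"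
  shows "integrable M (\<lambda>\<omega>. Z \<omega> * f (T n \<omega>) :: real)"
proof -
  obtain K' where K': "AE \<omega> in M. \<bar>f (T n \<omega>)\<bar> \<le> K'" using T_fun_bounded[OF n] by blast
  have [measurable]: "(\<lambda>\<omega>. f (T n \<omega>)) \<in> borel_measurable M"
    by (rule measurable_compose[OF T_measurable[OF n]]) simp
  show ?thesis
  proof (rule integrable_const_bound[where B = "K * K'"])
    show "AE \<omega> in M. norm (Z \<omega> * f (T n \<omega>)) \<le> K * K'"
      using Z(2) K' by eventually_elim (auto simp: abs_mult intro!: mult_mono)
  qed (use Z in measurable)
qed

lemma integrable_T_fun: "n \<ge> 2 \<Longrightarrow> integrable M (\<lambda>\<omega>. f (T n \<omega>) :: real)"
  using integrable_mult_T_fun[of n "\<lambda>_. 1" 1 f] by simp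

text \<open>
  The Markov property of \<open>T\<close>, tested against a variable \<open>Z\<close> that is known at time \<open>n\<close>.
\<close>

lemma expectation_next_tree:
  fixes f :: "nat set set \<Rightarrow> real"
  assumes n: "n \<ge> 2" and Z: "past_determined n Z" "AE \<omega> in M. \<bar>Z \<omega>\<bar> \<le> K"
  shows "expectation (\<lambda>\<omega>. Z \<omega> * f (T (Suc n) \<omega>)) =
    expectation (\<lambda>\<omega>. Z \<omega> * step_mean n (T n \<omega>) (\<lambda>w. f (attach_leaf n w (T n \<omega>))))"
proof -
  have "expectation (\<lambda>\<omega>. Z \<omega> * f (T (Suc n) \<omega>)) = expectation (\<lambda>\<omega>. Z \<omega> * f (attach_leaf n (W n \<omega>) (T n \<omega>)))"
    by (rule Bochner_Integration.integral_cong) (use n in \<open>auto simp: T_Suc\<close>)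
  also have "\<dots> = expectation (\<lambda>\<omega>. step_mean n (T n \<omega>) (\<lambda>w. Z \<omega> * f (attach_leaf n w (T n \<omega>))))"
  proof (rule one_step(2)[OF n])
    fix w
    show "past_determined n (\<lambda>\<omega>. Z \<omega> * f (attach_leaf n w (T n \<omega>)))"
      using Z(1) past_eq_T[of n _ _ n] n unfolding past_determined_def by (metis order_refl)
    show "integrable M (\<lambda>\<omega>. Z \<omega> * f (attach_leaf n w (T n \<omega>)))"
      by (rule integrable_mult_T_fun[OF n _ Z(2), where f = "\<lambda>E. f (attach_leaf n w E)"])
        (rule past_determined_measurable(2)[OF Z(1)])
  qed
  finally show ?thesis by (simp add: step_mean_cmult)
qed

section \<open>Convergence of the scaled degree energy\<close>

lemma past_determined_T: 
  "2 \<le> m \<Longrightarrow> m \<le> n \<Longrightarrow> past_determined n (\<lambda>\<omega>. f (T m \<omega>))"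
  unfolding past_determined_def by (intro ballI impI arg_cong[where f = f] past_eq_T[of n])

lemma past_determined_diff:
  "past_determined n f \<Longrightarrow> past_determined n g \<Longrightarrow> past_determined n (\<lambda>\<omega>. f \<omega> - g \<omega>)"
  unfolding past_determined_def by (intro ballI impI arg_cong2[where f = "(-)"]) blast+

text \<open>
  Doob's decomposition: with \<open>q n\<close> the mean of \<open>y (n+1)\<close> after one step, the process differs from its initial
  value by the partial sums of the martingale differences \<open>N\<close> minus those of the nonnegative drifts \<open>A\<close>.
  Indices are shifted by \<open>2\<close>, the size of the initial tree.
\<close>

lemma nonneg_supermartingale_converges:
  fixes y :: "nat \<Rightarrow> nat set set \<Rightarrow> real"
  assumes nonneg: "\<And>n E. grown n E \<Longrightarrow> y n E \<ge> 0"
    and super: "\<And>n E. grown n E \<Longrightarrow> step_mean n E (\<lambda>w. y (Suc n) (attach_leaf n w E)) \<le> y n E"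
    and incr: "\<And>n E w. grown n E \<Longrightarrow> w \<in> {1..n} \<Longrightarrow>
        \<bar>y (Suc n) (attach_leaf n w E) - y n E\<bar> \<le> C / real n"
  shows "AE \<omega> in M. convergent (\<lambda>n. y n (T n \<omega>))"
proof -
  define q where "q n E = step_mean n E (\<lambda>w. y (Suc n) (attach_leaf n w E))" for n E
  define N where "N i \<omega> = y (i + 3) (T (i + 3) \<omega>) - q (i + 2) (T (i + 2) \<omega>)" for i \<omega>
  define A where "A i \<omega> = y (i + 2) (T (i + 2) \<omega>) - q (i + 2) (T (i + 2) \<omega>)" for i \<omega>
  note int = integrable_T_fun
  have E_q: "expectation (\<lambda>\<omega>. y (Suc n) (T (Suc n) \<omega>)) = expectation (\<lambda>\<omega>. q n (T n \<omega>))" if "n \<ge> 2" for n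
    using expectation_next_tree[OF that, of "\<lambda>_. 1" 1 "y (Suc n)"] by (simp add: past_determined_def q_def)
  have C: "C \<ge> 0"
    using order_trans[OF abs_ge_zero incr[OF grown.edge, of 1]] by simp
  have q_close: "\<bar>q n E - y n E\<bar> \<le> C / real n" if "grown n E" for n E
    unfolding q_def using incr[OF that] by (intro step_mean_abs_diff_le that) auto
  have N_int: "integrable M (N i)" for i
    unfolding N_def by (intro Bochner_Integration.integrable_diff int) auto
  have N_bound: "AE \<omega> in M. \<bar>N i \<omega>\<bar> \<le> (2 * C) / real (Suc i)" for i
  proof -
    have n: "i + 2 \<ge> 2" by simp
    show ?thesis
      using T_grown[OF n] W_range[OF n n] AE_space
    proof eventually_elim
      case (elim \<omega>)
      have "\<bar>y (i + 3) (T (i + 3) \<omega>) - y (i + 2) (T (i + 2) \<omega>)\<bar> \<le> C / real (i + 2)"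
        using incr[OF elim(1,2)] T_Suc[OF n elim(3)] by (simp add: numeral_3_eq_3)
      then have "\<bar>N i \<omega>\<bar> \<le> 2 * C / real (i + 2)"
        unfolding N_def using q_close[OF elim(1)] by (simp add: add_divide_distrib)
      also have "\<dots> \<le> 2 * C / real (Suc i)" using C by (intro divide_left_mono) auto
      finally show ?case .
    qed
  qed
  have "AE \<omega> in M. summable (\<lambda>i. N i \<omega>)"
  proof (rule orthogonal_AE_summable[where C = "2 * C"])
    show "N i \<in> borel_measurable M" for i using N_int[of i] by auto
    fix i j :: nat assume ij: "i < j"
    have det: "past_determined (j + 2) (N i)"
      unfolding N_def using ij by (intro past_determined_diff past_determined_T) auto
    have bd: "AE \<omega> in M. \<bar>N i \<omega>\<bar> \<le> 2 * C / real (Suc i)" using N_bound .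
    have "expectation (\<lambda>\<omega>. N i \<omega> * N j \<omega>)
      = expectation (\<lambda>\<omega>. N i \<omega> * y (j + 3) (T (j + 3) \<omega>)) - expectation (\<lambda>\<omega>. N i \<omega> * q (j + 2) (T (j + 2) \<omega>))"
      unfolding N_def[of j] right_diff_distrib
      by (intro Bochner_Integration.integral_diff integrable_mult_T_fun[where f = "y (j + 3)", OF _ _ bd]
          integrable_mult_T_fun[where f = "q (j + 2)", OF _ _ bd]) (use N_int[of i] in auto)
    also have "expectation (\<lambda>\<omega>. N i \<omega> * y (j + 3) (T (j + 3) \<omega>)) = expectation (\<lambda>\<omega>. N i \<omega> * q (j + 2) (T (j + 2) \<omega>))"
      using expectation_next_tree[OF _ det bd, of "y (j + 3)"] by (simp add: q_def numeral_3_eq_3)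
    finally show "expectation (\<lambda>\<omega>. N i \<omega> * N j \<omega>) = 0" by simp
  qed (rule N_bound)
  moreover have "AE \<omega> in M. summable (\<lambda>i. A i \<omega>)"
  proof (rule nonneg_AE_summable)
    show "integrable M (A i)" for i
      unfolding A_def by (intro Bochner_Integration.integrable_diff int) auto
    show "AE \<omega> in M. 0 \<le> A i \<omega>" for i
      using T_grown[of "i + 2"] by (auto simp: A_def q_def super)
    fix m
    have E_A: "expectation (A i) = expectation (\<lambda>\<omega>. y (i + 2) (T (i + 2) \<omega>)) - expectation (\<lambda>\<omega>. y (Suc i + 2) (T (Suc i + 2) \<omega>))" for i
      unfolding A_def using int[of "i + 2"] E_q[of "i + 2"] by (subst Bochner_Integration.integral_diff) auto
    have "(\<Sum>i<m. expectation (A i)) = expectation (\<lambda>\<omega>. y 2 (T 2 \<omega>)) - expectation (\<lambda>\<omega>. y (m + 2) (T (m + 2) \<omega>))"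
      by (induction m) (simp_all add: E_A numeral_2_eq_2)
    moreover have "expectation (\<lambda>\<omega>. y (m + 2) (T (m + 2) \<omega>)) \<ge> 0"
      using T_grown[of "m + 2"] nonneg by (intro integral_nonneg_AE) auto
    ultimately show "(\<Sum>i<m. expectation (A i)) \<le> expectation (\<lambda>\<omega>. y 2 (T 2 \<omega>))" by simp
  qed
  ultimately show ?thesis
  proof eventually_elim
    case (elim \<omega>)
    have "y (m + 2) (T (m + 2) \<omega>) = y 2 (T 2 \<omega>) + (\<Sum>i<m. N i \<omega>) - (\<Sum>i<m. A i \<omega>)" for m
      by (induction m) (auto simp: N_def A_def numeral_3_eq_3 numeral_2_eq_2)
    then have "(\<lambda>m. y (m + 2) (T (m + 2) \<omega>)) \<longlonglongrightarrow> y 2 (T 2 \<omega>) + (\<Sum>i. N i \<omega>) - (\<Sum>i. A i \<omega>)"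
      using elim by (simp only:) (intro tendsto_intros summable_LIMSEQ)
    then have "(\<lambda>n. y n (T n \<omega>)) \<longlonglongrightarrow> y 2 (T 2 \<omega>) + (\<Sum>i. N i \<omega>) - (\<Sum>i. A i \<omega>)"
      by (rule LIMSEQ_offset)
    then show ?case by (auto simp: convergent_def)
  qed
qed

lemma degree_energy_converges: "AE \<omega> in M. convergent (\<lambda>n. degree_energy n (T n \<omega>) / real n ^ 2)"
proof -
  have "AE \<omega> in M. convergent (\<lambda>n. scaled_energy n (T n \<omega>))"
    by (rule nonneg_supermartingale_converges[OF _ scaled_energy_supermartingale scaled_energy_increment])
      (auto simp: scaled_energy_def degree_energy_nonneg)
  then show ?thesis
  proof eventually_elim
    case (elim \<omega>)
    then obtain l where l: "(\<lambda>n. scaled_energy n (T n \<omega>)) \<longlonglongrightarrow> l" by (auto simp: convergent_def)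
    have a: "(\<lambda>n. 2 / (real n + 1)) \<longlonglongrightarrow> 0" and b: "(\<lambda>n. (real n + 1) / real n) \<longlonglongrightarrow> 1"
    proof -
      have "(\<lambda>n. 2 * inverse (real (Suc n))) \<longlonglongrightarrow> 2 * 0"
        by (intro tendsto_mult tendsto_const LIMSEQ_inverse_real_of_nat)
      then show "(\<lambda>n. 2 / (real n + 1)) \<longlonglongrightarrow> 0" by (simp add: divide_inverse add.commute)
      show "(\<lambda>n. (real n + 1) / real n) \<longlonglongrightarrow> 1"
        using LIMSEQ_Suc_n_over_n[where 'a = real] by (simp add: add.commute)
    qed
    have "(\<lambda>n. (scaled_energy n (T n \<omega>) - 2 / (real n + 1)) * ((real n + 1) / real n)) \<longlonglongrightarrow> (l - 0) * 1"
      by (intro tendsto_intros l a b)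
    moreover have "(scaled_energy n (T n \<omega>) - 2 / (real n + 1)) * ((real n + 1) / real n) = degree_energy n (T n \<omega>) / real n ^ 2" for n
    proof -
      have "real n + 1 \<noteq> 0" by simp
      then show ?thesis by (simp add: scaled_energy_def divide_simps power2_eq_square)
    qed
    ultimately show ?case by (auto simp: convergent_def)
  qed
qed

section \<open>Positivity of the limit\<close>

lemma past_determined_indicator:
  assumes "\<And>x y. x \<in> space M \<Longrightarrow> y \<in> space M \<Longrightarrow> past T V W n x = past T V W n y \<Longrightarrow> x \<in> A \<longleftrightarrow> y \<in> A"
  shows "past_determined n (indicator A)"
  unfolding past_determined_def
proof (intro ballI impI)
  fix x y assume "x \<in> space M" "y \<in> space M" "past T V W n x = past T V W n y"
  from assms[OF this] show "indicator A x = (indicator A y :: real)" by (simp add: indicator_def)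
qed

text \<open>
  No vertex has had \<open>k\<close> leaves up to time \<open>n\<close>. Taking all times up to \<open>n\<close> makes the events decrease in \<open>n\<close>, so
  that successive differences describe the first time at which \<open>k\<close> leaves occur.
\<close>

definition few_leaves :: "nat \<Rightarrow> nat \<Rightarrow> 'a set" where
  "few_leaves k n = {\<omega>\<in>space M. \<forall>i\<in>{2..n}. \<forall>u. leaf_count (T i \<omega>) u < k}"

lemma few_leaves_cong:
  assumes "n \<le> N" "x \<in> space M" "y \<in> space M" "past T V W N x = past T V W N y"
  shows "x \<in> few_leaves k n \<longleftrightarrow> y \<in> few_leaves k n"
proof -
  have "T i x = T i y" if "i \<in> {2..n}" for i
    using that assms(1) by (intro past_eq_T[OF assms(4)]) auto
  then show ?thesis using assms(2,3) by (auto simp: few_leaves_def)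
qed

lemma few_leaves_determined: "past_determined n (indicator (few_leaves k n))"
  by (intro past_determined_indicator few_leaves_cong[OF order_refl])

lemma indicator_event: 
  assumes "past_determined n (indicator A)" "A \<subseteq> space M"
  shows "A \<in> sets M"
proof -
  have "(indicator A :: 'a \<Rightarrow> real) \<in> borel_measurable M" by (rule past_determined_measurable(2)[OF assms(1)])
  then have "indicator A -` {1::real} \<inter> space M \<in> sets M" by (rule measurable_sets) simp
  moreover have "indicator A -` {1::real} \<inter> space M = A" using assms(2) by (auto simp: indicator_def split: if_splits)
  ultimately show ?thesis by simp
qed

lemma few_leaves_event: "few_leaves k n \<in> sets M"
  by (rule indicator_event[OF few_leaves_determined]) (auto simp: few_leaves_def)

text \<open>
  On this event the average \<open>s\<close> of \<open>l(u)\<^sup>2\<close> is at most \<open>k\<^sup>2\<close>, while its conditional mean increases by at least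
  \<open>1/(n + 1)\<close>. The nonnegative quantity \<open>g n\<close>, the mean of \<open>k\<^sup>2 - s\<close> over the event, thus falls by at least
  \<open>P(few_leaves k n)/(n + 1)\<close> in each step, and if these probabilities did not tend to \<open>0\<close>, the
  harmonic series would make it negative.
\<close>

lemma few_leaves_null:
  assumes k: "k \<ge> 1"
  shows "(\<lambda>n. prob (few_leaves k (n + 2))) \<longlonglongrightarrow> 0"
proof -
  define s where "s n E = leaf_energy n E / real n" for n E
  define g where "g n = expectation (\<lambda>\<omega>. indicator (few_leaves k n) \<omega> * (real k ^ 2 - s n (T n \<omega>)))" for n
  have s_bound: "s n E \<le> real k ^ 2" if "grown n E" "\<And>u. leaf_count E u \<le> k" for n E
  proof -
    have "leaf_energy n E \<le> (\<Sum>u=1..n. real k ^ 2)"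
      unfolding leaf_energy_def by (intro sum_mono power_mono) (use that in auto)
    then show ?thesis using grown_ge_2[OF that(1)] by (simp add: s_def divide_le_eq mult.commute)
  qed
  have g_nonneg: "g n \<ge> 0" if n: "n \<ge> 2" for n
    unfolding g_def
  proof (rule integral_nonneg_AE)
    show "AE \<omega> in M. 0 \<le> indicator (few_leaves k n) \<omega> * (real k ^ 2 - s n (T n \<omega>))"
      using T_grown[OF n]
    proof eventually_elim
      case (elim \<omega>)
      then show ?case using s_bound[OF elim] n by (auto simp: few_leaves_def indicator_def less_imp_le)
    qed
  qed
  have int: "integrable M (\<lambda>\<omega>. indicator (few_leaves k m) \<omega> * f (T n \<omega>) :: real)" if "n \<ge> 2" "m \<ge> 2" for m n f
    by (rule integrable_mult_T_fun[where K = 1]) (use that few_leaves_event in \<open>auto simp: indicator_def\<close>)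
  have g_step: "g (Suc n) \<le> g n - prob (few_leaves k n) / real (Suc n)" if n: "n \<ge> 2" for n
  proof -
    have "g (Suc n) \<le> expectation (\<lambda>\<omega>. indicator (few_leaves k n) \<omega> * (real k ^ 2 - s (Suc n) (T (Suc n) \<omega>)))"
      unfolding g_def
    proof (intro integral_mono_AE)
      show "AE \<omega> in M. indicator (few_leaves k (Suc n)) \<omega> * (real k ^ 2 - s (Suc n) (T (Suc n) \<omega>))
          \<le> indicator (few_leaves k n) \<omega> * (real k ^ 2 - s (Suc n) (T (Suc n) \<omega>))"
        using T_grown[OF n] T_grown[OF le_SucI[OF n]] W_range[OF n n] AE_space
      proof eventually_elim
        case (elim \<omega>)
        show ?case
        proof (cases "\<omega> \<in> few_leaves k n")
          case True
          then have few: "leaf_count (T n \<omega>) u < k" for u using n by (auto simp: few_leaves_def)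
          \<comment> \<open>One step beyond the event, a leaf count can reach \<open>k\<close> but not exceed it.\<close>
          have "leaf_count (T (Suc n) \<omega>) u \<le> k" for u
          proof -
            consider "u \<in> {1..n}" | "u = Suc n" | "u \<notin> {1..Suc n}" by fastforce
            then show ?thesis
            proof cases
              case 1
              then show ?thesis
                using leaf_count_attach(1)[OF elim(1,3) 1] few[of u] T_Suc[OF n elim(4)] by auto
            next
              case 2
              then show ?thesis
                using leaf_count_attach(2)[OF elim(1,3)] T_Suc[OF n elim(4)] k by simp
            next
              case 3
              then show ?thesis using leaf_count_outside[of "Suc n" "T (Suc n) \<omega>" u] elim(2) n by simp
            qed
          qed
          then have "s (Suc n) (T (Suc n) \<omega>) \<le> real k ^ 2" using s_bound elim(2) n by simp
          then show ?thesis using True by (auto simp: indicator_def)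
        next
          case False
          then have "\<omega> \<notin> few_leaves k (Suc n)" by (auto simp: few_leaves_def)
          with False show ?thesis by simp
        qed
      qed
    qed (use n int[of "Suc n" _ "\<lambda>E. real k ^ 2 - s (Suc n) E"] in auto)
    also have "\<dots> = expectation (\<lambda>\<omega>. indicator (few_leaves k n) \<omega> *
        step_mean n (T n \<omega>) (\<lambda>w. real k ^ 2 - s (Suc n) (attach_leaf n w (T n \<omega>))))"
      by (rule expectation_next_tree[OF n few_leaves_determined, of k 1 "\<lambda>E. real k ^ 2 - s (Suc n) E"]) auto
    also have "\<dots> \<le> expectation (\<lambda>\<omega>. indicator (few_leaves k n) \<omega> * (real k ^ 2 - s n (T n \<omega>) - 1 / real (Suc n)))"
    proof (intro integral_mono_AE)
      show "AE \<omega> in M. indicator (few_leaves k n) \<omega> *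
          step_mean n (T n \<omega>) (\<lambda>w. real k ^ 2 - s (Suc n) (attach_leaf n w (T n \<omega>)))
        \<le> indicator (few_leaves k n) \<omega> * (real k ^ 2 - s n (T n \<omega>) - 1 / real (Suc n))"
        using T_grown[OF n]
      proof eventually_elim
        case (elim \<omega>)
        define L where "L = step_mean n (T n \<omega>) (\<lambda>w. leaf_energy (Suc n) (attach_leaf n w (T n \<omega>)))"
        have "step_mean n (T n \<omega>) (\<lambda>w. real k ^ 2 - s (Suc n) (attach_leaf n w (T n \<omega>)))
          = step_mean n (T n \<omega>) (\<lambda>w. real k ^ 2 + (- 1 / real (Suc n)) * leaf_energy (Suc n) (attach_leaf n w (T n \<omega>)))"
          by (simp add: s_def)
        also have "\<dots> = real k ^ 2 + (- 1 / real (Suc n)) * L"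
          by (simp only: step_mean_add step_mean_cmult step_mean_const[OF elim] L_def)
        also have "\<dots> \<le> real k ^ 2 - s n (T n \<omega>) - 1 / real (Suc n)"
        proof -
          have "(leaf_energy n (T n \<omega>) * (1 + 1 / real n) + 1) / real (Suc n) \<le> L / real (Suc n)"
            using step_mean_leaf_energy[OF elim] by (intro divide_right_mono) (auto simp: L_def)
          moreover have "(1 + 1 / real n) / real (Suc n) = 1 / real n"
          proof -
            have "real n > 0" "1 + real n > 0" using n by auto
            then show ?thesis by (simp add: divide_simps add.commute)
          qed
          then have "(leaf_energy n (T n \<omega>) * (1 + 1 / real n) + 1) / real (Suc n) = s n (T n \<omega>) + 1 / real (Suc n)"
            by (simp only: add_divide_distrib times_divide_eq_right[symmetric] s_def) simp
          ultimately show ?thesis by simp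
        qed
        finally show ?case by (intro mult_left_mono) auto
      qed
    qed (use n int[of n n "\<lambda>E. step_mean n E (\<lambda>w. real k ^ 2 - s (Suc n) (attach_leaf n w E))"]
          int[of n n "\<lambda>E. real k ^ 2 - s n E - 1 / real (Suc n)"] in auto)
    also have "\<dots> = g n - prob (few_leaves k n) / real (Suc n)"
    proof -
      have "expectation (\<lambda>\<omega>. indicator (few_leaves k n) \<omega> * (real k ^ 2 - s n (T n \<omega>) - 1 / real (Suc n)))
        = expectation (\<lambda>\<omega>. indicator (few_leaves k n) \<omega> * (real k ^ 2 - s n (T n \<omega>)) - indicator (few_leaves k n) \<omega> * (1 / real (Suc n)))"
        by (simp add: right_diff_distrib)
      also have "\<dots> = g n - expectation (\<lambda>\<omega>. indicator (few_leaves k n) \<omega> * (1 / real (Suc n)))"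
        unfolding g_def
        using int[OF n n, of "\<lambda>E. real k ^ 2 - s n E"] int[OF n n, of "\<lambda>E. 1 / real (Suc n)"]
        by (rule Bochner_Integration.integral_diff)
      also have "expectation (\<lambda>\<omega>. indicator (few_leaves k n) \<omega> * (1 / real (Suc n))) = prob (few_leaves k n) / real (Suc n)"
        using few_leaves_event by simp
      finally show ?thesis .
    qed
    finally show ?thesis .
  qed
  have dec: "decseq (\<lambda>n. prob (few_leaves k (n + 2)))"
    unfolding decseq_def
    by (intro allI impI finite_measure_mono few_leaves_event) (auto simp: few_leaves_def)
  obtain l where l: "(\<lambda>n. prob (few_leaves k (n + 2))) \<longlonglongrightarrow> l" "\<And>n. l \<le> prob (few_leaves k (n + 2))"
    using decseq_convergent[OF dec, of 0] by auto
  have "l \<le> 0"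
  proof (rule ccontr)
    assume "\<not> l \<le> 0"
    have sum: "(\<Sum>i<m. l / real (Suc (i + 2))) \<le> g 2 - g (m + 2)" for m
    proof (induction m)
      case (Suc m)
      have "l / real (Suc (m + 2)) \<le> prob (few_leaves k (m + 2)) / real (Suc (m + 2))"
        using l(2) by (intro divide_right_mono) auto
      then show ?case using Suc g_step[of "m + 2"] by simp
    qed (simp add: numeral_2_eq_2)
    have "summable (\<lambda>i. l / real (Suc (i + 2)))"
    proof (rule summableI_nonneg_bounded)
      show "(\<Sum>i<m. l / real (Suc (i + 2))) \<le> g 2" for m
        using sum[of m] g_nonneg[of "m + 2"] by simp
    qed (use \<open>\<not> l \<le> 0\<close> in auto)
    then have "summable (\<lambda>i. (1 / l) * (l / real (Suc (i + 2))))" by (rule summable_mult)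
    then have "summable (\<lambda>i. inverse (real (i + 3)))" using \<open>\<not> l \<le> 0\<close> by (simp add: divide_inverse numeral_3_eq_3)
    then show False
      using not_summable_harmonic[where 'a = real] summable_iff_shift[of "\<lambda>i. inverse (real i)" 3] by (simp add: inverse_eq_divide)
  qed
  moreover have "l \<ge> 0" using LIMSEQ_le_const[OF l(1), of 0] by auto
  ultimately show ?thesis using l(1) by simp
qed

text \<open>
  Follow the vertex that has \<open>k\<close> leaves at time \<open>m\<close>. Its truncated potential starts at \<open>2/(k - 3)\<close> or less and
  is a supermartingale. If \<open>L \<le> 0\<close>, the leaf count of this vertex is sublinear, as its square is bounded by
  the degree energy, so the potential is eventually equal to \<open>1\<close>. The mean of the limit therefore bounds
  the probability of this event.
\<close>

lemma leafy_vertex_survives: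
  fixes k m :: nat
  assumes m: "m \<ge> 2" and k: "k \<ge> 6"
    and A: "past_determined m (indicator A)" "A \<subseteq> space M"
    and leafy: "\<And>\<omega>. \<omega> \<in> A \<Longrightarrow> \<exists>u. leaf_count (T m \<omega>) u \<ge> k"
    and L [measurable]: "L \<in> borel_measurable M"
    and lim: "AE \<omega> in M. (\<lambda>n. degree_energy n (T n \<omega>) / real n ^ 2) \<longlonglongrightarrow> L \<omega>"
  shows "prob ({\<omega>\<in>space M. L \<omega> \<le> 0} \<inter> A) \<le> 2 / (real k - 3) * prob A"
proof -
  define c where "c E = (SOME u. leaf_count E u \<ge> k)" for E
  define P where "P n E E' = truncated_potential m n (leaf_count E (c E'))" for n E E'
  define H where "H = {\<omega>\<in>space M. L \<omega> \<le> 0}"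
  have P: "0 \<le> P n E E'" "P n E E' \<le> 1" for n E E' by (auto simp: P_def truncated_potential_bounds)
  have A_event [measurable]: "A \<in> sets M" by (rule indicator_event[OF A])
  have H_event [measurable]: "H \<in> sets M" unfolding H_def by measurable
  have det: "past_determined n (\<lambda>\<omega>. indicator A \<omega> * f (T n \<omega>) (T m \<omega>))" if n: "m \<le> n" for n f
  proof -
    have "indicator A x = (indicator A y :: real)"
      if "past T V W n x = past T V W n y" "x \<in> space M" "y \<in> space M" for x y
    proof -
      have "past T V W m x = past T V W m y"
        using that(1) n by (auto simp: past_def simp del: upt_Suc)
      then show ?thesis using A(1) that unfolding past_determined_def by blast
    qed
    moreover have "T n x = T n y \<and> T m x = T m y" if "past T V W n x = past T V W n y" for x y
      using past_eq_T[OF that] n m by auto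
    ultimately show ?thesis unfolding past_determined_def by metis
  qed
  have int: "integrable M (\<lambda>\<omega>. indicator A \<omega> * f (T n \<omega>) (T m \<omega>))" if "m \<le> n" "\<And>E E'. \<bar>f E E'\<bar> \<le> (1::real)" for n f
    by (rule integrable_const_bound[where B = 1, OF _ past_determined_measurable(2)[OF det[OF that(1)]]])
      (use that(2) in \<open>auto simp: indicator_def\<close>)
  have step: "expectation (\<lambda>\<omega>. indicator A \<omega> * P (Suc n) (T (Suc n) \<omega>) (T m \<omega>))
      \<le> expectation (\<lambda>\<omega>. indicator A \<omega> * P n (T n \<omega>) (T m \<omega>))" if n: "m \<le> n" for n
  proof -
    define h where "h w \<omega> = indicator A \<omega> * P (Suc n) (attach_leaf n w (T n \<omega>)) (T m \<omega>)" for w \<omega>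
    have n2: "n \<ge> 2" using n m by simp
    have h: "past_determined n (h w)" "integrable M (h w)" for w
      unfolding h_def using det[OF n, of "\<lambda>E E'. P (Suc n) (attach_leaf n w E) E'"]
        int[OF n, of "\<lambda>E E'. P (Suc n) (attach_leaf n w E) E'"] P by auto
    have "expectation (\<lambda>\<omega>. indicator A \<omega> * P (Suc n) (T (Suc n) \<omega>) (T m \<omega>)) = expectation (\<lambda>\<omega>. h (W n \<omega>) \<omega>)"
      by (rule Bochner_Integration.integral_cong) (auto simp: h_def T_Suc[OF n2])
    also have "\<dots> = expectation (\<lambda>\<omega>. step_mean n (T n \<omega>) (\<lambda>w. h w \<omega>))"
      by (rule one_step(2)[OF n2 h])
    also have "\<dots> = expectation (\<lambda>\<omega>. indicator A \<omega> * step_mean n (T n \<omega>) (\<lambda>w. P (Suc n) (attach_leaf n w (T n \<omega>)) (T m \<omega>)))"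
      by (simp only: h_def step_mean_cmult)
    also have "\<dots> \<le> expectation (\<lambda>\<omega>. indicator A \<omega> * P n (T n \<omega>) (T m \<omega>))"
    proof (rule integral_mono_AE')
      show "integrable M (\<lambda>\<omega>. indicator A \<omega> * P n (T n \<omega>) (T m \<omega>))" using int[OF n] P by auto
      show "AE \<omega> in M. indicator A \<omega> * step_mean n (T n \<omega>) (\<lambda>w. P (Suc n) (attach_leaf n w (T n \<omega>)) (T m \<omega>))
          \<le> indicator A \<omega> * P n (T n \<omega>) (T m \<omega>)"
        using T_grown[OF n2]
        by eventually_elim (intro mult_left_mono, use m n in \<open>auto simp: P_def intro!: step_mean_truncated_potential\<close>)
      show "AE \<omega> in M. 0 \<le> indicator A \<omega> * P n (T n \<omega>) (T m \<omega>)" using P by auto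
    qed
    finally show ?thesis .
  qed
  have start: "expectation (\<lambda>\<omega>. indicator A \<omega> * P m (T m \<omega>) (T m \<omega>)) \<le> 2 / (real k - 3) * prob A"
  proof -
    have "expectation (\<lambda>\<omega>. indicator A \<omega> * P m (T m \<omega>) (T m \<omega>)) \<le> expectation (\<lambda>\<omega>. indicator A \<omega> * (2 / (real k - 3)))"
    proof (rule integral_mono)
      show "integrable M (\<lambda>\<omega>. indicator A \<omega> * P m (T m \<omega>) (T m \<omega>))" using int[of m] P by auto
      show "integrable M (\<lambda>\<omega>. indicator A \<omega> * (2 / (real k - 3)))"
        by (intro integrable_mult_left integrable_real_indicator A_event) (simp add: emeasure_eq_measure)
      fix \<omega>
      have "P m (T m \<omega>) (T m \<omega>) \<le> 2 / (real k - 3)" if "\<omega> \<in> A"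
      proof -
        define l where "l = leaf_count (T m \<omega>) (c (T m \<omega>))"
        have l: "l \<ge> k" using leafy[OF that] unfolding l_def c_def by (rule someI_ex)
        have "P m (T m \<omega>) (T m \<omega>) \<le> 2 * leaf_potential l"
          using m by (simp add: P_def truncated_potential_def l_def)
        also have "\<dots> = 2 / (real l - 3)" using l k by (simp add: leaf_potential_def)
        also have "\<dots> \<le> 2 / (real k - 3)" using l k by (intro divide_left_mono) auto
        finally show ?thesis .
      qed
      then show "indicator A \<omega> * P m (T m \<omega>) (T m \<omega>) \<le> indicator A \<omega> * (2 / (real k - 3))"
        by (auto simp: indicator_def)
    qed
    then show ?thesis by (simp add: mult.commute)
  qed
  have bound: "expectation (\<lambda>\<omega>. indicator A \<omega> * P (n + m) (T (n + m) \<omega>) (T m \<omega>)) \<le> 2 / (real k - 3) * prob A" for n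
  proof (induction n)
    case (Suc n)
    then show ?case using step[of "n + m"] by simp
  qed (use start in simp)
  have "(\<lambda>n. expectation (\<lambda>\<omega>. indicator H \<omega> * (indicator A \<omega> * P (n + m) (T (n + m) \<omega>) (T m \<omega>))))
      \<longlonglongrightarrow> expectation (indicator (H \<inter> A))"
  proof (rule integral_dominated_convergence[where w = "\<lambda>_. 1"])
    have [measurable]: "(\<lambda>\<omega>. indicator A \<omega> * P (n + m) (T (n + m) \<omega>) (T m \<omega>)) \<in> borel_measurable M" for n
      by (rule past_determined_measurable(2)[OF det]) simp
    show "(\<lambda>\<omega>. indicator H \<omega> * (indicator A \<omega> * P (n + m) (T (n + m) \<omega>) (T m \<omega>))) \<in> borel_measurable M" for n
      by measurable
    show "AE \<omega> in M. norm (indicator H \<omega> * (indicator A \<omega> * P (n + m) (T (n + m) \<omega>) (T m \<omega>))) \<le> 1" for n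
      using P by (auto simp: indicator_def)
    have grown: "AE \<omega> in M. \<forall>n. n \<ge> 2 \<longrightarrow> grown n (T n \<omega>)"
      unfolding AE_all_countable using T_grown by auto
    show "AE \<omega> in M. (\<lambda>n. indicator H \<omega> * (indicator A \<omega> * P (n + m) (T (n + m) \<omega>) (T m \<omega>))) \<longlonglongrightarrow> indicator (H \<inter> A) \<omega>"
      using lim grown
    proof eventually_elim
      case (elim \<omega>)
      show ?case
      proof (cases "\<omega> \<in> H \<inter> A")
        case True
        then have "L \<omega> < 1 / real m ^ 2" using m by (auto simp: H_def intro: le_less_trans)
        with elim(1) have "eventually (\<lambda>n. degree_energy n (T n \<omega>) / real n ^ 2 < 1 / real m ^ 2) sequentially"
          by (rule order_tendstoD(2))
        then have "eventually (\<lambda>n. P n (T n \<omega>) (T m \<omega>) = 1) sequentially"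
          using eventually_ge_at_top[of m]
        proof eventually_elim
          case (elim n)
          have g: "grown n (T n \<omega>)" using elim(2) m \<open>\<forall>n\<ge>2. grown n (T n \<omega>)\<close> by simp
          define l where "l = leaf_count (T n \<omega>) (c (T m \<omega>))"
          have "real l ^ 2 \<le> degree_energy n (T n \<omega>)" unfolding l_def by (rule leaf_count_sq_le_energy[OF g])
          also have "\<dots> < (real n / real m) ^ 2"
            using elim m by (simp add: field_simps power_divide)
          finally have lt: "real l < real n / real m" by (rule power_less_imp_less_base) simp
          have "1 \<le> 2 * real n / real m * leaf_potential l"
          proof (cases "l \<ge> 1")
            case True
            have "1 \<le> real n / real m * (1 / real l)" using True lt m by (simp add: field_simps)
            also have "\<dots> \<le> 2 * real n / real m * leaf_potential l"
              using leaf_potential_bounds(3)[OF True] True by (intro mult_mono divide_right_mono) auto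
            finally show ?thesis .
          next
            case False
            then show ?thesis using elim m by (simp add: leaf_potential_def)
          qed
          then show ?case by (simp add: P_def truncated_potential_def l_def)
        qed
        then have "(\<lambda>n. P n (T n \<omega>) (T m \<omega>)) \<longlonglongrightarrow> 1" by (rule tendsto_eventually)
        then have "(\<lambda>n. P (n + m) (T (n + m) \<omega>) (T m \<omega>)) \<longlonglongrightarrow> 1" by (rule LIMSEQ_ignore_initial_segment)
        then show ?thesis using True by simp
      qed (auto simp: indicator_def)
    qed
  qed auto
  then have "(\<lambda>n. expectation (\<lambda>\<omega>. indicator H \<omega> * (indicator A \<omega> * P (n + m) (T (n + m) \<omega>) (T m \<omega>))))
      \<longlonglongrightarrow> prob (H \<inter> A)" by simp
  moreover have "expectation (\<lambda>\<omega>. indicator H \<omega> * (indicator A \<omega> * P (n + m) (T (n + m) \<omega>) (T m \<omega>)))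
      \<le> 2 / (real k - 3) * prob A" for n
  proof -
    have "expectation (\<lambda>\<omega>. indicator H \<omega> * (indicator A \<omega> * P (n + m) (T (n + m) \<omega>) (T m \<omega>)))
      \<le> expectation (\<lambda>\<omega>. indicator A \<omega> * P (n + m) (T (n + m) \<omega>) (T m \<omega>))"
      by (rule integral_mono_AE') (use int[of "n + m" "P (n + m)"] P in \<open>auto simp: indicator_def\<close>)
    then show ?thesis using bound[of n] by simp
  qed
  ultimately have "prob (H \<inter> A) \<le> 2 / (real k - 3) * prob A"
    by (intro LIMSEQ_le_const2) auto
  then show ?thesis by (simp add: H_def)
qed

text \<open>
  The event \<open>L \<le> 0\<close> is split according to the first time \<open>n\<close> at which some vertex has \<open>k\<close> leaves, and the
  previous lemma is applied to each part; the remaining part has vanishing probability.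
\<close>

lemma energy_limit_positive:
  assumes L [measurable]: "L \<in> borel_measurable M"
    and lim: "AE \<omega> in M. (\<lambda>n. degree_energy n (T n \<omega>) / real n ^ 2) \<longlonglongrightarrow> L \<omega>"
  shows "AE \<omega> in M. L \<omega> > 0"
proof -
  define H where "H = {\<omega>\<in>space M. L \<omega> \<le> 0}"
  have H_event [measurable]: "H \<in> sets M" unfolding H_def by measurable
  have split: "prob (H - few_leaves k n) \<le> 2 / (real k - 3) * (1 - prob (few_leaves k n))"
    if k: "k \<ge> 6" and n: "n \<ge> 2" for k n
    using n
  proof (induction n rule: dec_induct)
    case base
    have "prob (H \<inter> (space M - few_leaves k 2)) \<le> 2 / (real k - 3) * prob (space M - few_leaves k 2)"
      unfolding H_def
    proof (rule leafy_vertex_survives[OF _ k _ _ _ L lim])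
      show "past_determined 2 (indicator (space M - few_leaves k 2))"
      proof (rule past_determined_indicator)
        show "x \<in> space M - few_leaves k 2 \<longleftrightarrow> y \<in> space M - few_leaves k 2"
          if "x \<in> space M" "y \<in> space M" "past T V W 2 x = past T V W 2 y" for x y
          using few_leaves_cong[OF order_refl that] that by simp
      qed
    qed (auto simp: few_leaves_def not_less)
    also have "H \<inter> (space M - few_leaves k 2) = H - few_leaves k 2" by (auto simp: H_def)
    finally show ?case using few_leaves_event[of k 2] by (simp add: prob_compl)
  next
    case (step n)
    define A where "A = few_leaves k n - few_leaves k (Suc n)"
    have sub: "few_leaves k (Suc n) \<subseteq> few_leaves k n" by (auto simp: few_leaves_def)
    note ev [measurable] = few_leaves_event[of k n] few_leaves_event[of k "Suc n"]
    have "prob (H \<inter> A) \<le> 2 / (real k - 3) * prob A"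
      unfolding H_def
    proof (rule leafy_vertex_survives[OF _ k _ _ _ L lim, of "Suc n"])
      show "past_determined (Suc n) (indicator A)"
      proof (rule past_determined_indicator)
        show "x \<in> A \<longleftrightarrow> y \<in> A"
          if "x \<in> space M" "y \<in> space M" "past T V W (Suc n) x = past T V W (Suc n) y" for x y
          using few_leaves_cong[OF _ that, of n k] few_leaves_cong[OF _ that, of "Suc n" k]
          by (simp add: A_def)
      qed
      show "\<exists>u. k \<le> leaf_count (T (Suc n) \<omega>) u" if "\<omega> \<in> A" for \<omega>
      proof -
        from that obtain i u where iu: "i \<in> {2..Suc n}" "k \<le> leaf_count (T i \<omega>) u"
          by (auto simp: A_def few_leaves_def not_less)
        have "i \<notin> {2..n}" using that iu(2) unfolding A_def few_leaves_def by (auto simp: not_le[symmetric])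
        then have "i = Suc n" using iu(1) by auto
        then show ?thesis using iu(2) by blast
      qed
    qed (use step in \<open>auto simp: A_def few_leaves_def\<close>)
    moreover have "prob A = prob (few_leaves k n) - prob (few_leaves k (Suc n))"
      unfolding A_def by (rule finite_measure_Diff[OF ev sub])
    moreover have "H - few_leaves k (Suc n) = (H - few_leaves k n) \<union> (H \<inter> A)"
      using sub by (auto simp: A_def)
    then have "prob (H - few_leaves k (Suc n)) \<le> prob (H - few_leaves k n) + prob (H \<inter> A)"
      by (simp only:) (rule measure_Un_le; simp add: A_def)
    moreover define K where "K = 2 / (real k - 3)"
    ultimately show ?case using step.IH unfolding K_def[symmetric] by (simp add: algebra_simps)
  qed
  have bound: "prob H \<le> 2 / (real k - 3)" if k: "k \<ge> 6" for k
  proof (rule LIMSEQ_le_const)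
    have "(\<lambda>n. prob (few_leaves k (n + 2)) + 2 / (real k - 3)) \<longlonglongrightarrow> 0 + 2 / (real k - 3)"
      by (intro tendsto_add tendsto_const few_leaves_null) (use k in simp)
    then show "(\<lambda>n. prob (few_leaves k (n + 2)) + 2 / (real k - 3)) \<longlonglongrightarrow> 2 / (real k - 3)" by simp
    have "prob H \<le> prob (few_leaves k (n + 2)) + 2 / (real k - 3)" for n
    proof -
      have ev: "few_leaves k (n + 2) \<in> sets M" by (rule few_leaves_event)
      have "prob H \<le> prob (few_leaves k (n + 2) \<union> (H - few_leaves k (n + 2)))"
        by (intro finite_measure_mono) (use ev in auto)
      also have "\<dots> \<le> prob (few_leaves k (n + 2)) + prob (H - few_leaves k (n + 2))"
        by (intro measure_Un_le) (use ev in auto)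
      also have "prob (H - few_leaves k (n + 2)) \<le> 2 / (real k - 3) * (1 - prob (few_leaves k (n + 2)))"
        by (rule split[OF k]) simp
      also have "\<dots> \<le> 2 / (real k - 3)" using k by (intro mult_left_le) auto
      finally show ?thesis by simp
    qed
    then show "\<exists>N. \<forall>n\<ge>N. prob H \<le> prob (few_leaves k (n + 2)) + 2 / (real k - 3)" by blast
  qed
  have "prob H \<le> 0"
  proof (rule LIMSEQ_le_const)
    show "(\<lambda>k. 2 / (real k - 3)) \<longlonglongrightarrow> 0"
    proof (rule LIMSEQ_offset[where k = 4])
      have "(\<lambda>k. 2 * inverse (real (Suc k))) \<longlonglongrightarrow> 2 * 0"
        by (intro tendsto_mult tendsto_const LIMSEQ_inverse_real_of_nat)
      then show "(\<lambda>k. 2 / (real (k + 4) - 3)) \<longlonglongrightarrow> 0" by (simp add: divide_inverse add.commute)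
    qed
    show "\<exists>N. \<forall>k\<ge>N. prob H \<le> 2 / (real k - 3)" using bound by blast
  qed
  then have "prob H = 0" by (simp add: measure_le_0_iff)
  then have "AE \<omega> in M. \<omega> \<notin> H" using prob_eq_0[OF H_event] by simp
  then show ?thesis using AE_space by eventually_elim (auto simp: H_def)
qed

section \<open>The expected degree of the chosen neighbour\<close>

text \<open>
  The link to the theorem: averaging \<open>d(w)\<close> against the weights gives the degree energy, and \<open>one_step\<close>
  tested on the events of \<open>T n\<close> characterises the conditional expectation.
\<close>

lemma expected_degree_given_tree:
  assumes n: "n \<ge> 2"
  shows "integrable M (\<lambda>\<omega>. real (vertex_degree (T n \<omega>) (W n \<omega>)))"
    and "AE \<omega> in M. real_cond_exp M (sigma_of M (T n)) (\<lambda>\<omega>. real (vertex_degree (T n \<omega>) (W n \<omega>))) \<omega>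
      = degree_energy n (T n \<omega>) / real n"
    and "expectation (\<lambda>\<omega>. real (vertex_degree (T n \<omega>) (W n \<omega>)))
      = expectation (\<lambda>\<omega>. degree_energy n (T n \<omega>) / real n)"
proof -
  interpret G: finite_measure_subalgebra M "sigma_of M (T n)"
    by (rule finite_measure_subalgebra_sigma_of[OF T_measurable[OF n]])
  have step: "integrable M (\<lambda>\<omega>. indicator B (T n \<omega>) * real (vertex_degree (T n \<omega>) (W n \<omega>)))"
    "expectation (\<lambda>\<omega>. indicator B (T n \<omega>) * real (vertex_degree (T n \<omega>) (W n \<omega>)))
      = expectation (\<lambda>\<omega>. indicator B (T n \<omega>) * (degree_energy n (T n \<omega>) / real n))" for B
  proof -
    define h where "h w \<omega> = indicator B (T n \<omega>) * real (vertex_degree (T n \<omega>) w)" for w \<omega>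
    have h: "past_determined n (h w)" "integrable M (h w)" for w
      unfolding h_def using n
      by (auto intro: past_determined_T[of n n "\<lambda>E. indicator B E * real (vertex_degree E w)"]
          integrable_T_fun[of n "\<lambda>E. indicator B E * real (vertex_degree E w)"])
    show "integrable M (\<lambda>\<omega>. indicator B (T n \<omega>) * real (vertex_degree (T n \<omega>) (W n \<omega>)))"
      using one_step(1)[OF n, of h, OF h] by (simp add: h_def)
    show "expectation (\<lambda>\<omega>. indicator B (T n \<omega>) * real (vertex_degree (T n \<omega>) (W n \<omega>)))
      = expectation (\<lambda>\<omega>. indicator B (T n \<omega>) * (degree_energy n (T n \<omega>) / real n))"
      using one_step(2)[OF n, of h, OF h] by (simp only: h_def step_mean_cmult step_mean_degree)
  qed
  show int: "integrable M (\<lambda>\<omega>. real (vertex_degree (T n \<omega>) (W n \<omega>)))"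
    and "expectation (\<lambda>\<omega>. real (vertex_degree (T n \<omega>) (W n \<omega>)))
      = expectation (\<lambda>\<omega>. degree_energy n (T n \<omega>) / real n)"
    using step[of UNIV] by simp_all
  show "AE \<omega> in M. real_cond_exp M (sigma_of M (T n)) (\<lambda>\<omega>. real (vertex_degree (T n \<omega>) (W n \<omega>))) \<omega>
      = degree_energy n (T n \<omega>) / real n"
  proof (rule G.real_cond_exp_charact)
    show "(\<lambda>\<omega>. degree_energy n (T n \<omega>) / real n) \<in> borel_measurable (sigma_of M (T n))"
      by (rule measurable_sigma_of) simp
    show "integrable M (\<lambda>\<omega>. degree_energy n (T n \<omega>) / real n)"
      using integrable_T_fun[OF n, of "\<lambda>E. degree_energy n E / real n"] .
    fix A assume "A \<in> sets (sigma_of M (T n))"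
    then obtain B where B: "A = T n -` B \<inter> space M" by (auto simp: sets_sigma_of)
    have ind: "indicator A \<omega> = (indicator B (T n \<omega>) :: real)" if "\<omega> \<in> space M" for \<omega>
      using that by (auto simp: B indicator_def)
    have "(\<integral>\<omega>\<in>A. f \<omega> \<partial>M) = expectation (\<lambda>\<omega>. indicator B (T n \<omega>) * f \<omega>)" for f :: "'a \<Rightarrow> real"
      unfolding set_lebesgue_integral_def
      by (rule Bochner_Integration.integral_cong) (auto simp: ind)
    then show "(\<integral>\<omega>\<in>A. real (vertex_degree (T n \<omega>) (W n \<omega>)) \<partial>M) = (\<integral>\<omega>\<in>A. degree_energy n (T n \<omega>) / real n \<partial>M)"
      using step(2) by simp
  qed (rule int)
qed

end

theorem theorem3p3:
  fixes M :: "'a measure"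
    and T :: "nat \<Rightarrow> 'a \<Rightarrow> nat set set"
    and V W :: "nat \<Rightarrow> 'a \<Rightarrow> nat"
  assumes "random_friend_tree M T V W"
  shows "(\<exists>L \<in> borel_measurable M. AE \<omega> in M.
            (\<lambda>n. 1 / real n * real_cond_exp M (sigma_of M (T n))
                    (\<lambda>\<omega>. real (vertex_degree (T n \<omega>) (W n \<omega>))) \<omega>) \<longlonglongrightarrow> L \<omega>
            \<and> (L \<omega> :: real) > 0)
       \<and> (\<exists>c :: real. c > 0 \<and>
            (\<lambda>n. 1 / real n * (\<integral>\<omega>. real (vertex_degree (T n \<omega>) (W n \<omega>)) \<partial>M)) \<longlonglongrightarrow> c)"
proof -
  interpret random_friend_tree M T V W by fact
  \<comment> \<open>\<open>T n\<close> is unspecified, and possibly not measurable, for \<open>n < 2\<close>; hence the shift.\<close>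
  define e where "e n \<omega> = degree_energy (n + 2) (T (n + 2) \<omega>) / real (n + 2) ^ 2" for n \<omega>
  define L where "L \<omega> = lim (\<lambda>n. e n \<omega>)" for \<omega>
  have e_meas [measurable]: "e n \<in> borel_measurable M" for n
    unfolding e_def
    by (intro borel_measurable_integrable integrable_T_fun[where f = "\<lambda>E. degree_energy (n + 2) E / real (n + 2) ^ 2"]) simp
  have L_meas [measurable]: "L \<in> borel_measurable M" unfolding L_def by measurable
  have lim: "AE \<omega> in M. (\<lambda>n. degree_energy n (T n \<omega>) / real n ^ 2) \<longlonglongrightarrow> L \<omega>"
    using degree_energy_converges
  proof eventually_elim
    case (elim \<omega>)
    then obtain l where l: "(\<lambda>n. degree_energy n (T n \<omega>) / real n ^ 2) \<longlonglongrightarrow> l"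
      by (auto simp: convergent_def)
    have "(\<lambda>n. e n \<omega>) \<longlonglongrightarrow> l" unfolding e_def by (rule LIMSEQ_ignore_initial_segment[OF l])
    then show ?case using l by (simp add: L_def limI)
  qed
  have pos: "AE \<omega> in M. L \<omega> > 0" by (rule energy_limit_positive[OF L_meas lim])
  have "AE \<omega> in M. \<forall>n. n \<ge> 2 \<longrightarrow> real_cond_exp M (sigma_of M (T n)) (\<lambda>\<omega>. real (vertex_degree (T n \<omega>) (W n \<omega>))) \<omega>
      = degree_energy n (T n \<omega>) / real n"
    unfolding AE_all_countable using expected_degree_given_tree(2) by auto
  with lim pos have first: "AE \<omega> in M. (\<lambda>n. 1 / real n * real_cond_exp M (sigma_of M (T n))
      (\<lambda>\<omega>. real (vertex_degree (T n \<omega>) (W n \<omega>))) \<omega>) \<longlonglongrightarrow> L \<omega> \<and> L \<omega> > 0"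
  proof eventually_elim
    case (elim \<omega>)
    have "eventually (\<lambda>n. degree_energy n (T n \<omega>) / real n ^ 2 = 1 / real n * real_cond_exp M (sigma_of M (T n))
      (\<lambda>\<omega>. real (vertex_degree (T n \<omega>) (W n \<omega>))) \<omega>) sequentially"
      using eventually_ge_at_top[of 2]
      by eventually_elim (use elim(3) in \<open>simp add: power2_eq_square\<close>)
    then show ?case using Lim_transform_eventually[OF elim(1)] elim(2) by simp
  qed
  have conv: "(\<lambda>n. expectation (e n)) \<longlonglongrightarrow> expectation L" and L_int: "integrable M L"
  proof -
    have *: "AE \<omega> in M. (\<lambda>n. e n \<omega>) \<longlonglongrightarrow> L \<omega>"
      using lim by eventually_elim (unfold e_def, rule LIMSEQ_ignore_initial_segment)
    have **: "AE \<omega> in M. norm (e n \<omega>) \<le> 1" for n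
    proof -
      have "AE \<omega> in M. grown (n + 2) (T (n + 2) \<omega>)" by (rule T_grown) simp
      then show ?thesis
      proof eventually_elim
        case (elim \<omega>)
        have "real (n + 2) ^ 2 > 0" by simp
        with degree_energy_le[OF elim] degree_energy_nonneg[of "n + 2"] show ?case
          unfolding e_def by (simp del: of_nat_add add: divide_le_eq_1)
      qed
    qed
    show "(\<lambda>n. expectation (e n)) \<longlonglongrightarrow> expectation L" "integrable M L"
      by (rule integral_dominated_convergence[OF L_meas e_meas _ * **]
          integrable_dominated_convergence[OF L_meas e_meas _ * **], simp)+
  qed
  have "expectation L > 0"
  proof -
    have nonneg: "AE \<omega> in M. 0 \<le> L \<omega>" using pos by eventually_elim simp
    have "expectation L \<noteq> 0"
    proof
      assume "expectation L = 0"
      then have "AE \<omega> in M. L \<omega> = 0" using integral_nonneg_eq_0_iff_AE[OF L_int nonneg] by simp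
      then have "AE \<omega> in M. False" using pos by eventually_elim simp
      then show False by simp
    qed
    then show ?thesis using integral_nonneg_AE[OF nonneg] by simp
  qed
  moreover have "(\<lambda>n. 1 / real n * expectation (\<lambda>\<omega>. real (vertex_degree (T n \<omega>) (W n \<omega>)))) \<longlonglongrightarrow> expectation L"
  proof (rule LIMSEQ_offset[where k = 2])
    have "1 / real (n + 2) * expectation (\<lambda>\<omega>. real (vertex_degree (T (n + 2) \<omega>) (W (n + 2) \<omega>))) = expectation (e n)" for n
    proof -
      have "1 / real (n + 2) * expectation (\<lambda>\<omega>. real (vertex_degree (T (n + 2) \<omega>) (W (n + 2) \<omega>)))
        = expectation (\<lambda>\<omega>. 1 / real (n + 2) * (degree_energy (n + 2) (T (n + 2) \<omega>) / real (n + 2)))"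
        by (subst expected_degree_given_tree(3)) simp_all
      then show ?thesis unfolding e_def by (simp add: power2_eq_square)
    qed
    then show "(\<lambda>n. 1 / real (n + 2) * expectation (\<lambda>\<omega>. real (vertex_degree (T (n + 2) \<omega>) (W (n + 2) \<omega>)))) \<longlonglongrightarrow> expectation L"
      using conv by (simp only:)
  qed
  ultimately show ?thesis using first L_meas by blast
qed

end
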